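(* Let $\mathcal V_{W\dot W},\mathcal V_{P\dot P}$ be genops such that $\{\mathcal V_{W\dot W},\mathcal V_{P\dot P}\}$ is $\mathcal E$-linked through $\mathcal V^1_{WP},\mathcal V^2_{\dot W\dot P}$. (a) If $p(s)$ is a polynomial with no constant term, then $\{p(\mathcal V_{W\dot W}),p(\mathcal V_{P\dot P})\}$ is $\mathcal E$-linked through $\mathcal V^1_{WP},\mathcal V^2_{\dot W\dot P}$, and if one of $p(\mathcal V_{W\dot W}),p(\mathcal V_{P\dot P})$ is decoupled, so is the other. (b) If, in addition, $\mathcal V_{W\dot W}\circ W=(\mathcal V_{W\dot W}\circ\dot W)_W$, $\mathcal V_{W\dot W}\times W=(\mathcal V_{W\dot W}\times\dot W)_W$, $\mathcal V_{P\dot P}\circ P=(\mathcal V_{P\dot P}\circ\dot P)_P$ and $\mathcal V_{P\dot P}\times P=(\mathcal V_{P\dot P}\times\dot P)_P$, then $\{\mathcal V^{(0)}_{W\dot W},\mathcal V^{(0)}_{P\dot P}\}$ is $\mathcal E$-linked through $\mathcal V^1_{WP},\mathcal V^2_{\dot W\dot P}$, and for every polynomial $p(s)$, even one with a constant term, $\{p(\mathcal V_{W\dot W}),p(\mathcal V_{P\dot P})\}$ is $\mathcal E$-linked through $\mathcal V^1_{WP},\mathcal V^2_{\dot W\dot P}$, and if one of $p(\mathcal V_{W\dot W}),p(\mathcal V_{P\dot P})$ is decoupled, so is the other.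
   Context: Fix a field $\mathbb F$; all index sets are finite. A vector on $X$ is a function $X\to\mathbb F$. $W,\dot W$ are disjoint copies of each other (in bijection), $P,\dot P$ likewise, all four pairwise disjoint; subscripts such as $(\mathcal V^2_{\dot W\dot P})_{WP}$, $(\mathcal V_{W\dot W})_{WW_1}$ denote relabelling of index sets along bijections. $\mathcal V_{W\dot W}$, $\mathcal V_{P\dot P}$, $\mathcal V^1_{WP}$, $\mathcal V^2_{\dot W\dot P}$ denote linear subspaces of vectors on the indicated disjoint unions. $\mathcal V_{XY}\circ X:=\{f_X:(f_X,g_Y)\in\mathcal V_{XY}\text{ for some }g_Y\}$, $\mathcal V_{XY}\times X:=\{f_X:(f_X,0_Y)\in\mathcal V_{XY}\}$. For spaces on sets $X,Y$, $\mathcal V_X\leftrightarrow\mathcal V_Y$ is the space on $(X\setminus Y)\uplus(Y\setminus X)$ of all $(g_{X\setminus Y},h_{Y\setminus X})$ with $g\in\mathcal V_X$, $h\in\mathcal V_Y$ and $g,h$ equal on $X\cap Y$. $\mathcal V_{W\dot W}$ is a genop if $\mathcal V_{W\dot W}\circ W\supseteq(\mathcal V_{W\dot W}\circ\dot W)_W$ and $\mathcal V_{W\dot W}\times W\supseteq(\mathcal V_{W\dot W}\times\dot W)_W$. A space on $W\uplus\dot W$ is decoupled if it has the form $\mathcal V^1_W\oplus\mathcal V^2_{\dot W}$. (Same for $P,\dot P$.) $\{\mathcal V_{W\dot W},\mathcal V_{P\dot P}\}$ is $\mathcal E$-linked through $\mathcal V^1_{WP},\mathcal V^2_{\dot W\dot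 P}$ if $\mathcal V^1_{WP}\supseteq(\mathcal V^2_{\dot W\dot P})_{WP}$, $\mathcal V_{W\dot W}=\mathcal V_{P\dot P}\leftrightarrow(\mathcal V^1_{WP}\oplus\mathcal V^2_{\dot W\dot P})$ and $\mathcal V_{P\dot P}=\mathcal V_{W\dot W}\leftrightarrow(\mathcal V^1_{WP}\oplus\mathcal V^2_{\dot W\dot P})$. Polynomials (same for $P,\dot P$): $\mathcal V^1_{W\dot W}+_{\dot w}\mathcal V^2_{W\dot W}:=\{(f_W,g^1_{\dot W}+g^2_{\dot W}):(f_W,g^i_{\dot W})\in\mathcal V^i_{W\dot W}\}$; $\lambda^{\dot w}\mathcal V_{W\dot W}:=\{(f_W,\lambda g_{\dot W}):(f_W,g_{\dot W})\in\mathcal V_{W\dot W}\}+(0_W\oplus\mathcal V_{W\dot W}\times\dot W)$; $\mathcal V^1_{W\dot W}*\mathcal V^2_{W\dot W}:=(\mathcal V^1_{W\dot W})_{WW_1}\leftrightarrow(\mathcal V^2_{W\dot W})_{W_1\dot W}$ with $W_1$ a disjoint dummy copy of $W$; $\mathcal V^{(0)}_{W\dot W}:=I_{W\dot W}+_{\dot w}[\mathcal V_{W\dot W}\circ W\oplus\mathcal V_{W\dot W}\times\dot W]$ with $I_{W\dot W}=\{(f_W,f_{\dot W})\}$ ($f_{\dot W}$ the copy of $f_W$); $\mathcal V^{(1)}_{W\dot W}:=\mathcal V_{W\dot W}$; $\mathcal V^{(k)}_{W\dot W}:=\mathcal V^{(k-1)}_{W\dot W}*\mathcal V_{W\dot W}$.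 For $p(s)=\sum_{i=0}^n\alpha_is^i$, $p(\mathcal V_{W\dot W}):=\alpha_0^{\dot w}\mathcal V^{(0)}_{W\dot W}+_{\dot w}\cdots+_{\dot w}\alpha_n^{\dot w}\mathcal V^{(n)}_{W\dot W}$. *)

theory Defs
  imports
    "HOL-Library.Function_Algebras"
    "HOL-Library.Set_Algebras"
    "HOL-Computational_Algebra.Polynomial"
begin

text \<open>
  A vector on an index set \<open>X\<close> is a function that vanishes outside \<open>X\<close>. For disjoint
  \<open>X\<close> and \<open>Y\<close> the vector \<open>(f\<^sub>X, g\<^sub>Y)\<close> on their union is then \<open>f + g\<close> (pointwise sum), and
  the direct sum of a space on \<open>X\<close> and a space on \<open>Y\<close> is the elementwise sum \<open>U + V\<close> of
  sets of functions.
\<close>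

definition vecs :: "'i set \<Rightarrow> ('i \<Rightarrow> 'f::field) set" where
  "vecs X = {f. \<forall>i. i \<notin> X \<longrightarrow> f i = 0}"

definition fscale :: "'f::field \<Rightarrow> ('i \<Rightarrow> 'f) \<Rightarrow> 'i \<Rightarrow> 'f" where
  "fscale c f = (\<lambda>i. c * f i)"

global_interpretation fun_space: vector_space "fscale :: 'f::field \<Rightarrow> ('i \<Rightarrow> 'f) \<Rightarrow> 'i \<Rightarrow> 'f"
  by unfold_locales (auto simp: fscale_def fun_eq_iff algebra_simps)

definition space_on :: "'i set \<Rightarrow> ('i \<Rightarrow> 'f::field) set \<Rightarrow> bool" where
  "space_on X V \<longleftrightarrow> V \<subseteq> vecs X \<and> fun_space.subspace V"

definition vrestrict :: "'i set \<Rightarrow> ('i \<Rightarrow> 'f::field) \<Rightarrow> 'i \<Rightarrow> 'f" where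
  "vrestrict X f = (\<lambda>i. if i \<in> X then f i else 0)"

text \<open>The space \<open>V \<circ> X\<close> of all \<open>X\<close>-parts of elements of \<open>V\<close>.\<close>

definition restriction :: "('i \<Rightarrow> 'f::field) set \<Rightarrow> 'i set \<Rightarrow> ('i \<Rightarrow> 'f) set" where
  "restriction V X = vrestrict X ` V"

text \<open>The space \<open>V \<times> X\<close>; the padding of \<open>f\<^sub>X\<close> by \<open>0\<^sub>Y\<close> is \<open>f\<^sub>X\<close> itself in this encoding.\<close>

definition contraction :: "('i \<Rightarrow> 'f::field) set \<Rightarrow> 'i set \<Rightarrow> ('i \<Rightarrow> 'f) set" where
  "contraction V X = {f \<in> vecs X. f \<in> V}"

text \<open>
  The composition \<open>U \<leftrightarrow> V\<close> of a space \<open>U\<close> on \<open>X\<close> and a space \<open>V\<close> on \<open>Y\<close>. The index sets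
  are arguments, since they cannot be read off from \<open>U\<close> and \<open>V\<close>.
\<close>

definition matched ::
  "'i set \<Rightarrow> 'i set \<Rightarrow> ('i \<Rightarrow> 'f::field) set \<Rightarrow> ('i \<Rightarrow> 'f) set \<Rightarrow> ('i \<Rightarrow> 'f) set" where
  "matched X Y U V =
     {vrestrict (X - Y) g + vrestrict (Y - X) h | g h.
        g \<in> U \<and> h \<in> V \<and> (\<forall>i \<in> X \<inter> Y. g i = h i)}"

text \<open>
  Relabelling of a space on \<open>X\<close> along a map \<open>\<phi>\<close> that is injective on \<open>X\<close>; the result is a
  space on \<open>\<phi> ` X\<close>.
\<close>

definition relabel ::
  "('i \<Rightarrow> 'j) \<Rightarrow> 'i set \<Rightarrow> ('i \<Rightarrow> 'f::field) set \<Rightarrow> ('j \<Rightarrow> 'f) set" where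
  "relabel \<phi> X V = {f \<in> vecs (\<phi> ` X). vrestrict X (f \<circ> \<phi>) \<in> V}"

text \<open>
  Disjoint copies are realised by tags: a set \<open>A\<close> of names gives rise to the index set
  \<open>Plain ` A\<close>, its copy \<open>Dot ` A\<close>, and the auxiliary copy \<open>Dummy ` A\<close> needed only inside
  the product of two spaces. Corresponding elements carry the same name.
\<close>

datatype 'a index = Plain 'a | Dot 'a | Dummy 'a

abbreviation both :: "'a set \<Rightarrow> 'a index set" where
  "both A \<equiv> Plain ` A \<union> Dot ` A"

primrec dot_to_plain :: "'a index \<Rightarrow> 'a index" where
  "dot_to_plain (Plain a) = Plain a"
| "dot_to_plain (Dot a) = Plain a"
| "dot_to_plain (Dummy a) = Dummy a"

primrec dot_to_dummy :: "'a index \<Rightarrow> 'a index" where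
  "dot_to_dummy (Plain a) = Plain a"
| "dot_to_dummy (Dot a) = Dummy a"
| "dot_to_dummy (Dummy a) = Dummy a"

primrec plain_to_dummy :: "'a index \<Rightarrow> 'a index" where
  "plain_to_dummy (Plain a) = Dummy a"
| "plain_to_dummy (Dot a) = Dot a"
| "plain_to_dummy (Dummy a) = Dummy a"

definition genop :: "'a set \<Rightarrow> ('a index \<Rightarrow> 'f::field) set \<Rightarrow> bool" where
  "genop A V \<longleftrightarrow>
     space_on (both A) V \<and>
     relabel dot_to_plain (Dot ` A) (restriction V (Dot ` A)) \<subseteq> restriction V (Plain ` A) \<and>
     relabel dot_to_plain (Dot ` A) (contraction V (Dot ` A)) \<subseteq> contraction V (Plain ` A)"

definition decoupled :: "'a set \<Rightarrow> ('a index \<Rightarrow> 'f::field) set \<Rightarrow> bool" where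
  "decoupled A V \<longleftrightarrow>
     (\<exists>U1 U2. space_on (Plain ` A) U1 \<and> space_on (Dot ` A) U2 \<and> V = U1 + U2)"

text \<open>
  Here \<open>VW\<close> lives on the two copies of \<open>A\<close>, \<open>VP\<close> on the two copies of \<open>B\<close>, \<open>V1\<close> on the plain
  copies of \<open>A\<close> and \<open>B\<close>, and \<open>V2\<close> on their dotted copies.
\<close>

definition E_linked ::
  "'a set \<Rightarrow> 'a set \<Rightarrow> ('a index \<Rightarrow> 'f::field) set \<Rightarrow> ('a index \<Rightarrow> 'f) set \<Rightarrow>
   ('a index \<Rightarrow> 'f) set \<Rightarrow> ('a index \<Rightarrow> 'f) set \<Rightarrow> bool" where
  "E_linked A B VW VP V1 V2 \<longleftrightarrow>
     space_on (both A) VW \<and> space_on (both B) VP \<and>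
     space_on (Plain ` A \<union> Plain ` B) V1 \<and> space_on (Dot ` A \<union> Dot ` B) V2 \<and>
     relabel dot_to_plain (Dot ` A \<union> Dot ` B) V2 \<subseteq> V1 \<and>
     VW = matched (both B) (both A \<union> both B) VP (V1 + V2) \<and>
     VP = matched (both A) (both A \<union> both B) VW (V1 + V2)"

definition dot_plus ::
  "'a set \<Rightarrow> ('a index \<Rightarrow> 'f::field) set \<Rightarrow> ('a index \<Rightarrow> 'f) set \<Rightarrow> ('a index \<Rightarrow> 'f) set" where
  "dot_plus A U V =
     {f + (g1 + g2) | f g1 g2.
        f \<in> vecs (Plain ` A) \<and> g1 \<in> vecs (Dot ` A) \<and> g2 \<in> vecs (Dot ` A) \<and>
        f + g1 \<in> U \<and> f + g2 \<in> V}"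

definition dot_scale ::
  "'a set \<Rightarrow> 'f::field \<Rightarrow> ('a index \<Rightarrow> 'f) set \<Rightarrow> ('a index \<Rightarrow> 'f) set" where
  "dot_scale A c V =
     {f + fscale c g | f g. f \<in> vecs (Plain ` A) \<and> g \<in> vecs (Dot ` A) \<and> f + g \<in> V} +
     contraction V (Dot ` A)"

definition star ::
  "'a set \<Rightarrow> ('a index \<Rightarrow> 'f::field) set \<Rightarrow> ('a index \<Rightarrow> 'f) set \<Rightarrow> ('a index \<Rightarrow> 'f) set" where
  "star A U V =
     matched (Plain ` A \<union> Dummy ` A) (Dummy ` A \<union> Dot ` A)
       (relabel dot_to_dummy (both A) U) (relabel plain_to_dummy (both A) V)"

definition id_space :: "'a set \<Rightarrow> ('a index \<Rightarrow> 'f::field) set" where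
  "id_space A = {f \<in> vecs (both A). \<forall>a \<in> A. f (Dot a) = f (Plain a)}"

fun op_power :: "'a set \<Rightarrow> ('a index \<Rightarrow> 'f::field) set \<Rightarrow> nat \<Rightarrow> ('a index \<Rightarrow> 'f) set" where
  "op_power A V 0 =
     dot_plus A (id_space A) (restriction V (Plain ` A) + contraction V (Dot ` A))"
| "op_power A V (Suc 0) = V"
| "op_power A V (Suc (Suc k)) = star A (op_power A V (Suc k)) V"

primrec op_sum ::
  "'a set \<Rightarrow> (nat \<Rightarrow> 'f::field) \<Rightarrow> ('a index \<Rightarrow> 'f) set \<Rightarrow> nat \<Rightarrow> ('a index \<Rightarrow> 'f) set" where
  "op_sum A \<alpha> V 0 = dot_scale A (\<alpha> 0) (op_power A V 0)"
| "op_sum A \<alpha> V (Suc n) =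
     dot_plus A (op_sum A \<alpha> V n) (dot_scale A (\<alpha> (Suc n)) (op_power A V (Suc n)))"

text \<open>
  The polynomial is written as the sum of its monomials of exponents \<open>0, \<dots>, degree p\<close>,
  including those with coefficient zero. For the zero polynomial the only summand is the
  one of exponent \<open>0\<close>.
\<close>

definition op_poly :: "'a set \<Rightarrow> 'f::field poly \<Rightarrow> ('a index \<Rightarrow> 'f) set \<Rightarrow> ('a index \<Rightarrow> 'f) set" where
  "op_poly A p V = op_sum A (coeff p) V (degree p)"

end

theory Submission imports Defs begin

text \<open>
  A space on \<open>both A\<close> is the graph of a linear relation on the vectors over \<open>A\<close>, and likewise
  the spaces \<open>V1\<close> and \<open>V2\<close> are linear relations \<open>K\<close> and \<open>L\<close> between vectors over \<open>A\<close> and vectors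
  over \<open>B\<close>. Read this way, with \<open>R\<close> and \<open>S\<close> for the two spaces that are linked, linkage says
  \<open>L \<subseteq> K\<close>, \<open>R = K O S O L\<inverse>\<close> and \<open>S = K\<inverse> O R O L\<close>. The product of spaces is relational
  composition, and the other operations have equally simple descriptions. The linkage condition
  is preserved when \<open>(K, L, R, S)\<close> is replaced by \<open>(K\<inverse>, L\<inverse>, S, R)\<close>, so for every operation
  it suffices to express the result on the side of \<open>R\<close> through the one on the side of \<open>S\<close>.

  The proof rests on one observation, \<open>linked_kernel\<close>: if \<open>(0, d) \<in> K\<close> and \<open>d\<close> is in the domain
  of \<open>S\<close>, then \<open>(d, 0) \<in> S\<close>. Thus two \<open>K\<close>-partners of one vector, both in the domain of
  \<open>S\<close>, have the same images under \<open>S\<close>. This is what allows the middle factor \<open>L\<inverse> O K\<close> in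
  \<open>K O S O L\<inverse> O K O S O L\<inverse>\<close> to be cancelled: \<open>L \<subseteq> K\<close> means that a detour through
  \<open>L\<inverse>\<close> and \<open>K\<close> moves a vector by some \<open>d\<close> with \<open>(0, d) \<in> K\<close>, and for a genop the ranges
  lie in the domains, so \<open>d\<close> is in the domain of \<open>S\<close>. Hence powers of linked genops are linked
  (\<open>linked_relcomp\<close>). For sums (\<open>linked_rel_sum\<close>) the two summands may pick different
  \<open>K\<close>-partners of the same vector, and the observation identifies their images once the summands
  have equal domains; all powers, multiples and sums of powers of a genop do share its domain.

  The summand of exponent \<open>0\<close> of a polynomial with zero constant term is \<open>0\<close> times the zeroth
  power, which coincides with \<open>0\<close> times the space itself, so it is linked as a multiple. For the
  zeroth power itself the argument uses the agreement of the restrictions and contractions to the two copies: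
  \<open>linked_kernel\<close> shows that \<open>(e, 0)\<close> is in the relation for an error term \<open>e\<close>, whereas
  \<open>(0, e)\<close> is needed (\<open>linked_rel_unit\<close>). Finally, decoupled spaces are the product
  relations \<open>X \<times> Y\<close>, and composing such a relation with \<open>K\<close> and \<open>L\<inverse>\<close> gives a product again.
\<close>

section \<open>Linear relations\<close>

definition linear_relation :: "(('i \<Rightarrow> 'f::field) \<times> ('j \<Rightarrow> 'f)) set \<Rightarrow> bool" where
  "linear_relation R \<longleftrightarrow> (0, 0) \<in> R \<and>
     (\<forall>x y x' y'. (x, y) \<in> R \<longrightarrow> (x', y') \<in> R \<longrightarrow> (x + x', y + y') \<in> R) \<and>
     (\<forall>c x y. (x, y) \<in> R \<longrightarrow> (fscale c x, fscale c y) \<in> R)"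

lemma linear_relation_zero: "linear_relation R \<Longrightarrow> (0, 0) \<in> R"
  by (simp add: linear_relation_def)

lemma linear_relation_add:
  "linear_relation R \<Longrightarrow> (x, y) \<in> R \<Longrightarrow> (x', y') \<in> R \<Longrightarrow> (x + x', y + y') \<in> R"
  by (simp add: linear_relation_def)

lemma linear_relation_scale:
  "linear_relation R \<Longrightarrow> (x, y) \<in> R \<Longrightarrow> (fscale c x, fscale c y) \<in> R"
  by (simp add: linear_relation_def)

lemma linear_relation_diff:
  assumes "linear_relation R" "(x, y) \<in> R" "(x', y') \<in> R"
  shows "(x - x', y - y') \<in> R"
  using linear_relation_add[OF assms(1,2) linear_relation_scale[OF assms(1,3), of "- 1"]]
  by (simp add: fscale_def fun_diff_def plus_fun_def)

lemma linear_relation_converse: "linear_relation R \<Longrightarrow> linear_relation (R\<inverse>)"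
  by (simp add: linear_relation_def)

lemma linear_relation_relcomp:
  assumes "linear_relation R" "linear_relation S"
  shows "linear_relation (R O S)"
  unfolding linear_relation_def relcomp_unfold
  using assms by (fastforce simp: linear_relation_def)

definition rel_sum ::
  "(('i \<Rightarrow> 'f::field) \<times> ('j \<Rightarrow> 'f)) set \<Rightarrow> (('i \<Rightarrow> 'f) \<times> ('j \<Rightarrow> 'f)) set \<Rightarrow> (('i \<Rightarrow> 'f) \<times> ('j \<Rightarrow> 'f)) set"
  where "rel_sum R S = {(x, a + b) | x a b. (x, a) \<in> R \<and> (x, b) \<in> S}"

text \<open>
  The summand \<open>b\<close> matters for \<open>c = 0\<close> only: otherwise it is absorbed into \<open>a\<close>.
\<close>
definition rel_scale ::
  "'f::field \<Rightarrow> (('i \<Rightarrow> 'f) \<times> ('j \<Rightarrow> 'f)) set \<Rightarrow> (('i \<Rightarrow> 'f) \<times> ('j \<Rightarrow> 'f)) set"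
  where "rel_scale c R = {(x, fscale c a + b) | x a b. (x, a) \<in> R \<and> (0, b) \<in> R}"

text \<open>
  The identity on the domain of \<open>R\<close>, enlarged by the indeterminacy of \<open>R\<close>, so that it has the
  same images of \<open>0\<close> as \<open>R\<close>.
\<close>
definition rel_unit ::
  "(('i \<Rightarrow> 'f::field) \<times> ('i \<Rightarrow> 'f)) set \<Rightarrow> (('i \<Rightarrow> 'f) \<times> ('i \<Rightarrow> 'f)) set"
  where "rel_unit R = {(x, x + b) | x b. x \<in> Domain R \<and> (0, b) \<in> R}"

lemma linear_relation_rel_sum:
  assumes R: "linear_relation R" and S: "linear_relation S"
  shows "linear_relation (rel_sum R S)"
proof -
  have 0: "(0, 0) \<in> rel_sum R S"
    unfolding rel_sum_def using linear_relation_zero[OF R] linear_relation_zero[OF S]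
    by (auto intro!: exI[of _ 0])
  have add: "(x + x', y + y') \<in> rel_sum R S"
    if "(x, y) \<in> rel_sum R S" "(x', y') \<in> rel_sum R S" for x y x' y'
  proof -
    from that obtain a b a' b' where *: "y = a + b" "y' = a' + b'"
      "(x, a) \<in> R" "(x, b) \<in> S" "(x', a') \<in> R" "(x', b') \<in> S"
      unfolding rel_sum_def by blast
    then have "y + y' = (a + a') + (b + b')" by (simp add: algebra_simps)
    with * show ?thesis
      unfolding rel_sum_def using linear_relation_add[OF R] linear_relation_add[OF S] by blast
  qed
  have "(fscale c x, fscale c y) \<in> rel_sum R S" if "(x, y) \<in> rel_sum R S" for c x y
    using that linear_relation_scale[OF R] linear_relation_scale[OF S]
    unfolding rel_sum_def by (fastforce simp: fun_space.scale_right_distrib)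
  with 0 add show ?thesis unfolding linear_relation_def by blast
qed

lemma linear_relation_rel_scale:
  assumes R: "linear_relation R"
  shows "linear_relation (rel_scale c R)"
proof -
  have 0: "(0, 0) \<in> rel_scale c R"
    unfolding rel_scale_def using linear_relation_zero[OF R]
    by (auto intro!: exI[of _ 0])
  have add: "(x + x', y + y') \<in> rel_scale c R"
    if "(x, y) \<in> rel_scale c R" "(x', y') \<in> rel_scale c R" for x y x' y'
  proof -
    from that obtain a b a' b' where *: "y = fscale c a + b" "y' = fscale c a' + b'"
      "(x, a) \<in> R" "(0, b) \<in> R" "(x', a') \<in> R" "(0, b') \<in> R"
      unfolding rel_scale_def by blast
    then have "y + y' = fscale c (a + a') + (b + b')"
      by (simp add: algebra_simps fun_space.scale_right_distrib)
    moreover have "(0, b + b') \<in> R" using linear_relation_add[OF R *(4,6)] by simp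
    ultimately show ?thesis
      unfolding rel_scale_def using * linear_relation_add[OF R] by blast
  qed
  have "(fscale d x, fscale d y) \<in> rel_scale c R" if "(x, y) \<in> rel_scale c R" for d x y
  proof -
    from that obtain a b where *: "y = fscale c a + b" "(x, a) \<in> R" "(0, b) \<in> R"
      unfolding rel_scale_def by blast
    then have "fscale d y = fscale c (fscale d a) + fscale d b"
      by (simp add: fun_space.scale_right_distrib fun_space.scale_left_commute)
    moreover have "(0, fscale d b) \<in> R" using linear_relation_scale[OF R *(3), of d] by simp
    ultimately show ?thesis
      unfolding rel_scale_def using * linear_relation_scale[OF R] by blast
  qed
  with 0 add show ?thesis unfolding linear_relation_def by blast
qed

lemma linear_relation_rel_unit:
  assumes R: "linear_relation R"
  shows "linear_relation (rel_unit R)"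
proof -
  have 0: "(0, 0) \<in> rel_unit R"
    unfolding rel_unit_def using linear_relation_zero[OF R] by (auto intro!: exI[of _ 0])
  have add: "(x + x', y + y') \<in> rel_unit R"
    if "(x, y) \<in> rel_unit R" "(x', y') \<in> rel_unit R" for x y x' y'
  proof -
    from that obtain b b' a a' where *: "y = x + b" "y' = x' + b'"
      "(x, a) \<in> R" "(0, b) \<in> R" "(x', a') \<in> R" "(0, b') \<in> R"
      unfolding rel_unit_def by blast
    then have "y + y' = (x + x') + (b + b')" by (simp add: algebra_simps)
    moreover have "(0, b + b') \<in> R" using linear_relation_add[OF R *(4,6)] by simp
    ultimately show ?thesis
      unfolding rel_unit_def using * linear_relation_add[OF R] by blast
  qed
  have "(fscale d x, fscale d y) \<in> rel_unit R" if "(x, y) \<in> rel_unit R" for d x y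
  proof -
    from that obtain a b where *: "y = x + b" "(x, a) \<in> R" "(0, b) \<in> R"
      unfolding rel_unit_def by blast
    then have "fscale d y = fscale d x + fscale d b"
      by (simp add: fun_space.scale_right_distrib)
    moreover have "(0, fscale d b) \<in> R" using linear_relation_scale[OF R *(3), of d] by simp
    ultimately show ?thesis
      unfolding rel_unit_def using * linear_relation_scale[OF R] by blast
  qed
  with 0 add show ?thesis unfolding linear_relation_def by blast
qed

lemma Domain_rel_sum: "Domain (rel_sum R S) = Domain R \<inter> Domain S"
  by (auto simp: rel_sum_def)

lemma Domain_rel_scale: "linear_relation R \<Longrightarrow> Domain (rel_scale c R) = Domain R"
  by (auto simp: rel_scale_def Domain_unfold dest: linear_relation_zero)

lemma Domain_rel_unit: "linear_relation R \<Longrightarrow> Domain (rel_unit R) = Domain R"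
  by (auto simp: rel_unit_def Domain_unfold dest: linear_relation_zero)

text \<open>
  Multiplication by \<open>0\<close> remembers nothing but the domain and the images of \<open>0\<close>, and \<open>R\<close> shares
  these with its unit. This is why a vanishing constant term is harmless.
\<close>
lemma rel_scale_0_rel_unit:
  assumes "linear_relation R"
  shows "rel_scale 0 (rel_unit R) = rel_scale 0 R"
proof -
  have "(0, b) \<in> rel_unit R \<longleftrightarrow> (0, b) \<in> R" for b
    using linear_relation_zero[OF assms] by (auto simp: rel_unit_def)
  moreover have "(\<exists>a. (x, a) \<in> rel_unit R) \<longleftrightarrow> (\<exists>a. (x, a) \<in> R)" for x
    using Domain_rel_unit[OF assms] by blast
  ultimately show ?thesis
    unfolding rel_scale_def by (auto simp: set_eq_iff)
qed

section \<open>Linked linear relations\<close>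
definition linked ::
  "(('i \<Rightarrow> 'f::field) \<times> ('j \<Rightarrow> 'f)) set \<Rightarrow> (('i \<Rightarrow> 'f) \<times> ('j \<Rightarrow> 'f)) set \<Rightarrow>
   (('i \<Rightarrow> 'f) \<times> ('i \<Rightarrow> 'f)) set \<Rightarrow> (('j \<Rightarrow> 'f) \<times> ('j \<Rightarrow> 'f)) set \<Rightarrow> bool" where
  "linked K L R S \<longleftrightarrow>
     linear_relation K \<and> linear_relation L \<and> linear_relation R \<and> linear_relation S \<and>
     L \<subseteq> K \<and> R = K O S O L\<inverse> \<and> S = K\<inverse> O R O L"

lemma linked_sym: "linked K L R S \<Longrightarrow> linked (K\<inverse>) (L\<inverse>) S R"
  unfolding linked_def converse_converse converse_mono using linear_relation_converse by metis

lemma linked_linear: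
  "linked K L R S \<Longrightarrow> linear_relation R" "linked K L R S \<Longrightarrow> linear_relation S"
  "linked K L R S \<Longrightarrow> linear_relation K" "linked K L R S \<Longrightarrow> linear_relation L"
  unfolding linked_def by blast+

text \<open>
  The second equation is the first one for \<open>(K\<inverse>, L\<inverse>, S', R')\<close>, in the form in which the
  one-sided lemmas below deliver it.
\<close>
lemma linked_halves:
  assumes "linked K L R S" "linear_relation R'" "linear_relation S'"
    and "R' = K O S' O L\<inverse>" "S' = K\<inverse> O R' O (L\<inverse>)\<inverse>"
  shows "linked K L R' S'"
  using assms unfolding linked_def converse_converse by metis

lemma linked_subset: "linked K L R S \<Longrightarrow> (x, y) \<in> L \<Longrightarrow> (x, y) \<in> K"
  unfolding linked_def by blast

lemma linked_Range: "linked K L R S \<Longrightarrow> Range S \<subseteq> Range L"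
proof -
  have "Range (K\<inverse> O R O L) \<subseteq> Range L" by blast
  then show "linked K L R S \<Longrightarrow> Range S \<subseteq> Range L" unfolding linked_def by metis
qed

lemma linked_into:
  assumes "linked K L R S" "(x, y) \<in> K" "(y, y') \<in> S" "(x', y') \<in> L"
  shows "(x, x') \<in> R"
proof -
  have "(x, x') \<in> K O S O L\<inverse>" using assms(2-4) by blast
  then show ?thesis using assms(1) unfolding linked_def by metis
qed

lemma linked_from:
  assumes "linked K L R S" "(x, x') \<in> R"
  obtains y y' where "(x, y) \<in> K" "(y, y') \<in> S" "(x', y') \<in> L"
proof -
  have "(x, x') \<in> K O S O L\<inverse>" using assms unfolding linked_def by metis
  then show ?thesis using that by blast
qed

text \<open>
  An image \<open>q\<close> of \<open>d\<close> is transported by \<open>(0, d) \<in> K\<close> to an image of \<open>0\<close> under \<open>R\<close>, and this is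
  transported back by \<open>(0, 0) \<in> K\<close> to \<open>(0, q) \<in> S\<close>; it remains to subtract.
\<close>
lemma linked_kernel:
  assumes l: "linked K L R S" and d: "d \<in> Domain S" "(0, d) \<in> K"
  shows "(d, 0) \<in> S"
proof -
  from d obtain q where q: "(d, q) \<in> S" by blast
  then obtain u where u: "(u, q) \<in> L" using linked_Range[OF l] by blast
  have "(0, u) \<in> R" using linked_into[OF l d(2) q u] .
  moreover have "(0, 0) \<in> K" using linear_relation_zero[OF linked_linear(3)[OF l]] .
  ultimately have "(0, q) \<in> S" using linked_into[OF linked_sym[OF l], of 0 0 u q] u by blast
  then show ?thesis
    using linear_relation_diff[OF linked_linear(2)[OF l] q] by fastforce
qed

text \<open>
  Cancellation of \<open>L\<inverse> O K\<close> between \<open>S'\<close> and \<open>S\<close>: the range of \<open>S'\<close> is contained both in the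
  range of \<open>L\<close>, so that the detour exists, and in the domain of \<open>S\<close>, so that \<open>linked_kernel\<close>
  absorbs the displacement.
\<close>
lemma linked_relcomp_half:
  assumes l: "linked K L R S" and l': "linked K L R' S'" and rd: "Range S' \<subseteq> Domain S"
  shows "R' O R = K O (S' O S) O L\<inverse>"
proof
  note lin = linked_linear[OF l]
  show "R' O R \<subseteq> K O (S' O S) O L\<inverse>"
  proof clarify
    fix x z y assume "(x, z) \<in> R'" "(z, y) \<in> R"
    obtain p p' where p: "(x, p) \<in> K" "(p, p') \<in> S'" "(z, p') \<in> L"
      using linked_from[OF l' \<open>(x, z) \<in> R'\<close>] .
    obtain q q' where q: "(z, q) \<in> K" "(q, q') \<in> S" "(y, q') \<in> L"
      using linked_from[OF l \<open>(z, y) \<in> R\<close>] .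
    (* p' and q are two K-partners of z, so S does not distinguish them. *)
    have "(z, p') \<in> K" using p linked_subset[OF l] by blast
    then have "(0, p' - q) \<in> K" using linear_relation_diff[of K z p' z q] q lin by simp
    moreover have "p' - q \<in> Domain S"
    proof -
      obtain r where "(p', r) \<in> S" using p rd by blast
      then have "(p' - q, r - q') \<in> S" using q linear_relation_diff[OF lin(2)] by blast
      then show ?thesis by blast
    qed
    ultimately have "(p' - q, 0) \<in> S" by (intro linked_kernel[OF l])
    then have "(p', q') \<in> S" using linear_relation_add[of S "p' - q" 0 q q'] q lin by simp
    then show "(x, y) \<in> K O (S' O S) O L\<inverse>" using p q by blast
  qed
  show "K O (S' O S) O L\<inverse> \<subseteq> R' O R"
  proof clarify
    fix x p r q y assume *: "(x, p) \<in> K" "(p, r) \<in> S'" "(r, q) \<in> S" "(y, q) \<in> L"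
    (* Any L-partner z of the intermediate vector r splits the path into R' followed by R. *)
    then obtain z where z: "(z, r) \<in> L" using linked_Range[OF l'] by blast
    then have "(z, r) \<in> K" by (rule linked_subset[OF l])
    then show "(x, y) \<in> R' O R"
      using linked_into[OF l' *(1,2) z] linked_into[OF l _ *(3,4)] by blast
  qed
qed

lemma linked_relcomp:
  assumes l: "linked K L R S" "linked K L R' S'"
    and r: "Range S' \<subseteq> Domain S" "Range R' \<subseteq> Domain R"
  shows "linked K L (R' O R) (S' O S)"
  by (intro linked_halves[OF l(1)] linear_relation_relcomp linked_linear[OF l(1)] linked_linear[OF l(2)]
      linked_relcomp_half[OF l r(1)] linked_relcomp_half[OF l[THEN linked_sym] r(2)])

text \<open>
  Two elements of \<open>R\<close> and \<open>R'\<close> with the same first component may arise from different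
  \<open>K\<close>-partners \<open>p\<close> and \<open>q\<close>; the domain condition makes \<open>q - p\<close> subject to \<open>linked_kernel\<close>, so
  that \<open>q\<close> serves for both.
\<close>
lemma linked_rel_sum_half:
  assumes l: "linked K L R S" and l': "linked K L R' S'" and rd: "Domain S' \<subseteq> Domain S"
  shows "rel_sum R R' = K O rel_sum S S' O L\<inverse>"
proof
  note lin = linked_linear[OF l]
  show "rel_sum R R' \<subseteq> K O rel_sum S S' O L\<inverse>"
  proof
    fix z assume "z \<in> rel_sum R R'"
    then obtain x a b where z: "z = (x, a + b)" and xa: "(x, a) \<in> R" and xb: "(x, b) \<in> R'"
      unfolding rel_sum_def by blast
    obtain p p' where p: "(x, p) \<in> K" "(p, p') \<in> S" "(a, p') \<in> L"
      using linked_from[OF l xa] .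
    obtain q q' where q: "(x, q) \<in> K" "(q, q') \<in> S'" "(b, q') \<in> L"
      using linked_from[OF l' xb] .
    have "(0, q - p) \<in> K" using linear_relation_diff[of K x q x p] p q lin by simp
    moreover have "q - p \<in> Domain S"
    proof -
      obtain r where "(q, r) \<in> S" using q rd by blast
      then have "(q - p, r - p') \<in> S" using p linear_relation_diff[OF lin(2)] by blast
      then show ?thesis by blast
    qed
    ultimately have "(q - p, 0) \<in> S" by (intro linked_kernel[OF l])
    then have "(q, p') \<in> S" using linear_relation_add[of S "q - p" 0 p p'] p lin by simp
    then have "(q, p' + q') \<in> rel_sum S S'" using q unfolding rel_sum_def by blast
    moreover have "(a + b, p' + q') \<in> L" using p q linear_relation_add[OF lin(4)] by blast
    ultimately show "z \<in> K O rel_sum S S' O L\<inverse>" using z q by blast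
  qed
  show "K O rel_sum S S' O L\<inverse> \<subseteq> rel_sum R R'"
  proof
    fix z assume "z \<in> K O rel_sum S S' O L\<inverse>"
    then obtain x p a b y where z: "z = (x, y)" and
      *: "(x, p) \<in> K" "(p, a) \<in> S" "(p, b) \<in> S'" "(y, a + b) \<in> L"
      unfolding rel_sum_def by blast
    (* Only the sum a + b is known to have an L-partner y; the summand a has one as well,
       and the difference is then an L-partner of b. *)
    then obtain u where u: "(u, a) \<in> L" using linked_Range[OF l] by blast
    then have "(y - u, b) \<in> L" using linear_relation_diff[of L y "a + b" u a] * lin by simp
    then have "(x, u) \<in> R" "(x, y - u) \<in> R'"
      using linked_into[OF l *(1,2) u] linked_into[OF l' *(1,3)] by blast+
    moreover have "y = u + (y - u)" by simp
    ultimately show "z \<in> rel_sum R R'" unfolding rel_sum_def z by blast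
  qed
qed

lemma linked_rel_sum:
  assumes l: "linked K L R S" "linked K L R' S'"
    and r: "Domain S' \<subseteq> Domain S" "Domain R' \<subseteq> Domain R"
  shows "linked K L (rel_sum R R') (rel_sum S S')"
  by (intro linked_halves[OF l(1)] linear_relation_rel_sum linked_linear[OF l(1)] linked_linear[OF l(2)]
      linked_rel_sum_half[OF l r(1)] linked_rel_sum_half[OF l[THEN linked_sym] r(2)])

text \<open>
  Scaling leaves the first component alone, so the only point is that \<open>K\<close> and \<open>L\<close> match the
  images of \<open>0\<close> under \<open>R\<close> with those under \<open>S\<close>; one direction of this is \<open>linked_kernel\<close>.
\<close>
lemma linked_rel_scale_half:
  assumes l: "linked K L R S"
  shows "rel_scale c R = K O rel_scale c S O L\<inverse>"
proof
  note lin = linked_linear[OF l]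
  show "rel_scale c R \<subseteq> K O rel_scale c S O L\<inverse>"
  proof
    fix z assume "z \<in> rel_scale c R"
    then obtain x a b where z: "z = (x, fscale c a + b)" and xa: "(x, a) \<in> R" and xb: "(0, b) \<in> R"
      unfolding rel_scale_def by blast
    obtain p p' where p: "(x, p) \<in> K" "(p, p') \<in> S" "(a, p') \<in> L"
      using linked_from[OF l xa] .
    obtain d q where q: "(0, d) \<in> K" "(d, q) \<in> S" "(b, q) \<in> L"
      using linked_from[OF l xb] .
    have "(d, 0) \<in> S" using q by (intro linked_kernel[OF l]) blast+
    then have "(0, q) \<in> S" using linear_relation_diff[of S d q d 0] q lin by simp
    then have "(p, fscale c p' + q) \<in> rel_scale c S" using p unfolding rel_scale_def by blast
    moreover have "(fscale c a + b, fscale c p' + q) \<in> L"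
      using p q linear_relation_add[OF lin(4)] linear_relation_scale[OF lin(4)] by blast
    ultimately show "z \<in> K O rel_scale c S O L\<inverse>" using z p by blast
  qed
  show "K O rel_scale c S O L\<inverse> \<subseteq> rel_scale c R"
  proof
    fix z assume "z \<in> K O rel_scale c S O L\<inverse>"
    then obtain x p a b y where z: "z = (x, y)" and
      *: "(x, p) \<in> K" "(p, a) \<in> S" "(0, b) \<in> S" "(y, fscale c a + b) \<in> L"
      unfolding rel_scale_def by blast
    then obtain u where u: "(u, a) \<in> L" using linked_Range[OF l] by blast
    then have "(fscale c u, fscale c a) \<in> L" by (rule linear_relation_scale[OF lin(4)])
    then have "(y - fscale c u, b) \<in> L"
      using linear_relation_diff[of L y "fscale c a + b" "fscale c u" "fscale c a"] * lin by simp
    moreover have "(0, 0) \<in> K" by (rule linear_relation_zero[OF lin(3)])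
    ultimately have "(x, u) \<in> R" "(0, y - fscale c u) \<in> R"
      using linked_into[OF l *(1,2) u] linked_into[OF l _ *(3)] by blast+
    moreover have "y = fscale c u + (y - fscale c u)" by simp
    ultimately show "z \<in> rel_scale c R" unfolding rel_scale_def z by blast
  qed
qed

lemma linked_rel_scale:
  assumes l: "linked K L R S"
  shows "linked K L (rel_scale c R) (rel_scale c S)"
  by (intro linked_halves[OF l] linear_relation_rel_scale linked_linear[OF l]
      linked_rel_scale_half[OF l] linked_rel_scale_half[OF linked_sym[OF l]])

text \<open>
  Since domain and range agree, an element of the domain of \<open>R\<close> has an \<open>L\<close>-partner \<open>p\<close>, which is
  also a \<open>K\<close>-partner; this handles one inclusion. In the other one, a vector \<open>x\<close> enters through
  \<open>K\<close> and a vector \<open>y\<close> leaves through \<open>L\<close>. The error \<open>u - x\<close> between \<open>x\<close> and an \<open>L\<close>-partner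
  \<open>u\<close> of the same \<open>p\<close> satisfies \<open>(u - x, 0) \<in> R\<close>, and the kernel hypothesis moves it to the
  second component.
\<close>
lemma linked_rel_unit_half:
  assumes l: "linked K L R S"
    and dr: "Domain R = Range R" "Domain S = Range S"
    and ker: "\<And>x. (x, 0) \<in> R \<longleftrightarrow> (0, x) \<in> R"
  shows "rel_unit R = K O rel_unit S O L\<inverse>"
proof
  note lin = linked_linear[OF l]
  have zero: "(0, 0) \<in> K" by (rule linear_relation_zero[OF lin(3)])
  show "rel_unit R \<subseteq> K O rel_unit S O L\<inverse>"
  proof
    fix z assume "z \<in> rel_unit R"
    then obtain x g where z: "z = (x, x + g)" and x: "x \<in> Domain R" and g: "(0, g) \<in> R"
      unfolding rel_unit_def by blast
    obtain p where p: "(x, p) \<in> L" using x dr linked_Range[OF linked_sym[OF l]] by blast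
    obtain x' where x': "(x, x') \<in> R" using x by blast
    then obtain p' where "(x', p') \<in> L" using linked_Range[OF linked_sym[OF l]] by blast
    then have "p \<in> Domain S"
      using linked_into[OF linked_sym[OF l]] linked_subset[OF l p] p x' by blast
    moreover obtain h where h: "(g, h) \<in> L" using g linked_Range[OF linked_sym[OF l]] by blast
    moreover have "(0, h) \<in> S" using linked_into[OF linked_sym[OF l]] g h zero by blast
    ultimately have "(p, p + h) \<in> rel_unit S" unfolding rel_unit_def by blast
    moreover have "(x + g, p + h) \<in> L" using p h linear_relation_add[OF lin(4)] by blast
    ultimately show "z \<in> K O rel_unit S O L\<inverse>" using linked_subset[OF l p] unfolding z by blast
  qed
  show "K O rel_unit S O L\<inverse> \<subseteq> rel_unit R"
  proof
    fix z assume "z \<in> K O rel_unit S O L\<inverse>"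
    then obtain x p p' g y where z: "z = (x, y)" and
      *: "(x, p) \<in> K" "(p, p') \<in> S" "(0, g) \<in> S" "(y, p + g) \<in> L"
      unfolding rel_unit_def by blast
    then obtain u where u: "(u, p) \<in> L" using linked_Range[OF l] dr by blast
    then have uK: "(u, p) \<in> K" by (rule linked_subset[OF l])
    obtain q where q: "(q, p') \<in> L" using linked_Range[OF l] * by blast
    have "(y - u, g) \<in> L" using linear_relation_diff[of L y "p + g" u p] * u lin by simp
    then have yu: "(0, y - u) \<in> R" using linked_into[OF l zero *(3)] by blast
    have xq: "(x, q) \<in> R" and uq: "(u, q) \<in> R"
      using linked_into[OF l *(1,2) q] linked_into[OF l uK *(2) q] .
    (* x and u have the common image q, and the common K-partner p. *)
    then have "u - x \<in> Domain R" using linear_relation_diff[OF lin(1)] by blast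
    moreover have "(u - x, 0) \<in> K" using linear_relation_diff[of K u p x p] uK *(1) lin by simp
    ultimately have "(u - x, 0) \<in> R" by (intro linked_kernel[OF linked_sym[OF l]]) auto
    then have "(0, u - x) \<in> R" using ker by blast
    then have "(0, y - x) \<in> R" using linear_relation_add[of R 0 "u - x" 0 "y - u"] yu lin by simp
    moreover have "y = x + (y - x)" by simp
    ultimately show "z \<in> rel_unit R" unfolding rel_unit_def z using xq by blast
  qed
qed

lemma linked_rel_unit:
  assumes l: "linked K L R S"
    and dr: "Domain R = Range R" "Domain S = Range S"
    and ker: "\<And>x. (x, 0) \<in> R \<longleftrightarrow> (0, x) \<in> R" "\<And>y. (y, 0) \<in> S \<longleftrightarrow> (0, y) \<in> S"
  shows "linked K L (rel_unit R) (rel_unit S)"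
  by (intro linked_halves[OF l] linear_relation_rel_unit linked_linear[OF l]
      linked_rel_unit_half[OF l dr ker(1)] linked_rel_unit_half[OF linked_sym[OF l] dr(2,1) ker(2)])

lemma linked_product:
  assumes l: "linked K L R S" and S: "S = X \<times> Y"
  shows "\<exists>X' Y'. R = X' \<times> Y'"
proof -
  have "R = K O (X \<times> Y) O L\<inverse>" using l unfolding linked_def S by (elim conjE)
  also have "\<dots> = {x. \<exists>y\<in>X. (x, y) \<in> K} \<times> {x. \<exists>y\<in>Y. (x, y) \<in> L}" by blast
  finally show ?thesis by blast
qed

section \<open>Spaces as relations\<close>

text \<open>
  Both components are indexed by names, so that they can be compared and added directly; the
  relabelling of the dotted to the plain copy becomes \<open>pair_vec 0 u \<mapsto> pair_vec u 0\<close>.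
\<close>
definition pair_vec :: "('a \<Rightarrow> 'f::field) \<Rightarrow> ('a \<Rightarrow> 'f) \<Rightarrow> 'a index \<Rightarrow> 'f" where
  "pair_vec u v = case_index u v (\<lambda>_. 0)"

lemma pair_vec_simps [simp]:
  "pair_vec u v (Plain a) = u a" "pair_vec u v (Dot a) = v a" "pair_vec u v (Dummy a) = 0"
  by (simp_all add: pair_vec_def)

lemma index_fun_eq_iff:
  "f = g \<longleftrightarrow> (\<forall>a. f (Plain a) = g (Plain a) \<and> f (Dot a) = g (Dot a) \<and> f (Dummy a) = g (Dummy a))"
  by (metis (full_types) ext index.exhaust)

lemma pair_vec_eq_iff [simp]: "pair_vec u v = pair_vec u' v' \<longleftrightarrow> u = u' \<and> v = v'"
  by (auto simp: index_fun_eq_iff)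

lemma pair_vec_add: "pair_vec u v + pair_vec u' v' = pair_vec (u + u') (v + v')"
  by (simp add: index_fun_eq_iff)

lemma pair_vec_scale: "fscale c (pair_vec u v) = pair_vec (fscale c u) (fscale c v)"
  by (simp add: index_fun_eq_iff fscale_def)

lemma pair_vec_zero: "pair_vec 0 0 = 0"
  by (simp add: index_fun_eq_iff)

lemma vecs_simps:
  "pair_vec u v \<in> vecs (both A) \<longleftrightarrow> u \<in> vecs A \<and> v \<in> vecs A"
  "pair_vec u v \<in> vecs (Plain ` A) \<longleftrightarrow> u \<in> vecs A \<and> v = 0"
  "pair_vec u v \<in> vecs (Dot ` A) \<longleftrightarrow> u = 0 \<and> v \<in> vecs A"
  by (auto simp: vecs_def fun_eq_iff) (metis index.exhaust pair_vec_simps image_eqI)+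

lemma vecs_cases:
  "f \<in> vecs (both A) \<Longrightarrow> f = pair_vec (f \<circ> Plain) (f \<circ> Dot)"
  "f \<in> vecs (Plain ` A) \<Longrightarrow> f = pair_vec (f \<circ> Plain) 0"
  "f \<in> vecs (Dot ` A) \<Longrightarrow> f = pair_vec 0 (f \<circ> Dot)"
  by (auto simp: vecs_def index_fun_eq_iff)

lemma vecs_iff:
  "f \<in> vecs (both A) \<longleftrightarrow> (\<exists>u\<in>vecs A. \<exists>v\<in>vecs A. f = pair_vec u v)"
  "f \<in> vecs (Plain ` A) \<longleftrightarrow> (\<exists>u\<in>vecs A. f = pair_vec u 0)"
  "f \<in> vecs (Dot ` A) \<longleftrightarrow> (\<exists>v\<in>vecs A. f = pair_vec 0 v)"
  using vecs_cases[of f A] by (metis vecs_simps)+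

lemma vecs_zero: "0 \<in> vecs X"
  by (simp add: vecs_def)

lemma vecs_add: "f \<in> vecs X \<Longrightarrow> g \<in> vecs X \<Longrightarrow> f + g \<in> vecs X"
  by (simp add: vecs_def)

lemma vecs_scale: "f \<in> vecs X \<Longrightarrow> fscale c f \<in> vecs X"
  by (simp add: vecs_def fscale_def)

definition op_rel :: "('a index \<Rightarrow> 'f::field) set \<Rightarrow> (('a \<Rightarrow> 'f) \<times> ('a \<Rightarrow> 'f)) set" where
  "op_rel V = {(u, v). pair_vec u v \<in> V}"

lemma op_rel_iff [simp]: "(u, v) \<in> op_rel V \<longleftrightarrow> pair_vec u v \<in> V"
  by (simp add: op_rel_def)

lemma space_on_iff_linear_relation:
  "space_on (both A) V \<longleftrightarrow> V \<subseteq> vecs (both A) \<and> linear_relation (op_rel V)"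
proof -
  have "fun_space.subspace V \<longleftrightarrow> linear_relation (op_rel V)" if V: "V \<subseteq> vecs (both A)"
  proof -
    have *: "(\<forall>f\<in>V. P f) \<longleftrightarrow> (\<forall>u v. pair_vec u v \<in> V \<longrightarrow> P (pair_vec u v))" for P
      using V vecs_cases(1) by (metis subsetD)
    show ?thesis
      unfolding fun_space.subspace_def linear_relation_def * op_rel_iff
        pair_vec_add pair_vec_scale pair_vec_zero by blast
  qed
  then show ?thesis by (auto simp: space_on_def)
qed

lemma op_rel_bounds:
  assumes "V \<subseteq> vecs (both A)" "pair_vec u v \<in> V"
  shows "u \<in> vecs A" "v \<in> vecs A"
  using assms by (auto simp: vecs_simps dest!: subsetD)

text \<open>
  Vectors on \<open>both A\<close> vanish on the dummy copy, so each of them is a \<open>pair_vec\<close>; identities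
  between spaces can therefore be checked on their relations.
\<close>
lemma op_rel_inject:
  assumes "U \<subseteq> vecs (both A)" "V \<subseteq> vecs (both A)" "op_rel U = op_rel V"
  shows "U = V"
  using assms vecs_cases(1) unfolding set_eq_iff by (metis op_rel_iff subsetD)

section \<open>Operations on spaces as relations\<close>

lemma op_rel_dot_plus:
  assumes "U \<subseteq> vecs (both A)" "V \<subseteq> vecs (both A)"
  shows "op_rel (dot_plus A U V) = rel_sum (op_rel U) (op_rel V)"
    and "dot_plus A U V \<subseteq> vecs (both A)"
proof -
  have "f \<in> dot_plus A U V \<longleftrightarrow>
      (\<exists>u a b. f = pair_vec u (a + b) \<and> pair_vec u a \<in> U \<and> pair_vec u b \<in> V)" for f
  proof
    assume "f \<in> dot_plus A U V"
    then obtain u a b where "f = pair_vec u 0 + (pair_vec 0 a + pair_vec 0 b)"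
      "pair_vec u 0 + pair_vec 0 a \<in> U" "pair_vec u 0 + pair_vec 0 b \<in> V"
      unfolding dot_plus_def vecs_iff by blast
    then show "\<exists>u a b. f = pair_vec u (a + b) \<and> pair_vec u a \<in> U \<and> pair_vec u b \<in> V"
      by (auto simp: pair_vec_add)
  next
    assume "\<exists>u a b. f = pair_vec u (a + b) \<and> pair_vec u a \<in> U \<and> pair_vec u b \<in> V"
    then obtain u a b where *: "f = pair_vec u (a + b)" "pair_vec u a \<in> U" "pair_vec u b \<in> V"
      by blast
    then have "f = pair_vec u 0 + (pair_vec 0 a + pair_vec 0 b)"
      "pair_vec u 0 + pair_vec 0 a \<in> U" "pair_vec u 0 + pair_vec 0 b \<in> V"
      by (auto simp: pair_vec_add)
    then show "f \<in> dot_plus A U V"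
      unfolding dot_plus_def vecs_iff
      using op_rel_bounds[OF assms(1) *(2)] op_rel_bounds[OF assms(2) *(3)] by blast
  qed
  then show "op_rel (dot_plus A U V) = rel_sum (op_rel U) (op_rel V)"
    and "dot_plus A U V \<subseteq> vecs (both A)"
    using op_rel_bounds[OF assms(1)] op_rel_bounds[OF assms(2)]
    by (auto simp: rel_sum_def op_rel_def vecs_simps vecs_add)
qed

lemma contraction_iff:
  "f \<in> contraction V (Dot ` A) \<longleftrightarrow> (\<exists>v\<in>vecs A. f = pair_vec 0 v \<and> pair_vec 0 v \<in> V)"
  "f \<in> contraction V (Plain ` A) \<longleftrightarrow> (\<exists>u\<in>vecs A. f = pair_vec u 0 \<and> pair_vec u 0 \<in> V)"
  unfolding contraction_def by (auto simp: vecs_iff)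

lemma restriction_iff:
  assumes "V \<subseteq> vecs (both A)"
  shows "f \<in> restriction V (Plain ` A) \<longleftrightarrow> (\<exists>u\<in>Domain (op_rel V). f = pair_vec u 0)"
    and "f \<in> restriction V (Dot ` A) \<longleftrightarrow> (\<exists>v\<in>Range (op_rel V). f = pair_vec 0 v)"
proof -
  have 1: "vrestrict (Plain ` A) (pair_vec u v) = pair_vec u 0"
    and 2: "vrestrict (Dot ` A) (pair_vec u v) = pair_vec 0 v" if "pair_vec u v \<in> V" for u v
    using op_rel_bounds[OF assms that] by (auto simp: vrestrict_def index_fun_eq_iff vecs_def)
  have *: "(\<exists>g\<in>V. P g) \<longleftrightarrow> (\<exists>u v. pair_vec u v \<in> V \<and> P (pair_vec u v))" for P
    using assms vecs_cases(1) by (metis subsetD)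
  show "f \<in> restriction V (Plain ` A) \<longleftrightarrow> (\<exists>u\<in>Domain (op_rel V). f = pair_vec u 0)"
    unfolding restriction_def image_iff *
    unfolding Bex_def Domain_iff op_rel_iff using 1 by metis
  show "f \<in> restriction V (Dot ` A) \<longleftrightarrow> (\<exists>v\<in>Range (op_rel V). f = pair_vec 0 v)"
    unfolding restriction_def image_iff *
    unfolding Bex_def Range_iff op_rel_iff using 2 by metis
qed

lemma op_rel_dot_scale:
  assumes "V \<subseteq> vecs (both A)"
  shows "op_rel (dot_scale A c V) = rel_scale c (op_rel V)"
    and "dot_scale A c V \<subseteq> vecs (both A)"
proof -
  have "f \<in> dot_scale A c V \<longleftrightarrow>
      (\<exists>u a b. f = pair_vec u (fscale c a + b) \<and> pair_vec u a \<in> V \<and> pair_vec 0 b \<in> V)" for f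
  proof
    assume "f \<in> dot_scale A c V"
    then obtain u a b where "f = (pair_vec u 0 + fscale c (pair_vec 0 a)) + pair_vec 0 b"
      "pair_vec u 0 + pair_vec 0 a \<in> V" "pair_vec 0 b \<in> V"
      unfolding dot_scale_def vecs_iff set_plus_def mem_Collect_eq Bex_def contraction_iff by blast
    then show "\<exists>u a b. f = pair_vec u (fscale c a + b) \<and> pair_vec u a \<in> V \<and> pair_vec 0 b \<in> V"
      by (auto simp: pair_vec_add pair_vec_scale)
  next
    assume "\<exists>u a b. f = pair_vec u (fscale c a + b) \<and> pair_vec u a \<in> V \<and> pair_vec 0 b \<in> V"
    then obtain u a b where *: "f = pair_vec u (fscale c a + b)" "pair_vec u a \<in> V" "pair_vec 0 b \<in> V"
      by blast
    then have "f = (pair_vec u 0 + fscale c (pair_vec 0 a)) + pair_vec 0 b"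
      "pair_vec u 0 + pair_vec 0 a \<in> V"
      by (auto simp: pair_vec_add pair_vec_scale)
    then show "f \<in> dot_scale A c V"
      unfolding dot_scale_def vecs_iff set_plus_def mem_Collect_eq Bex_def contraction_iff
      using * op_rel_bounds[OF assms *(2)] op_rel_bounds[OF assms *(3)] by blast
  qed
  then show "op_rel (dot_scale A c V) = rel_scale c (op_rel V)"
    and "dot_scale A c V \<subseteq> vecs (both A)"
    using op_rel_bounds[OF assms]
    by (auto simp: rel_scale_def op_rel_def vecs_simps vecs_add vecs_scale)
qed

lemma op_rel_power_0:
  fixes V :: "('a index \<Rightarrow> 'f::field) set"
  assumes V: "V \<subseteq> vecs (both A)"
  shows "op_rel (op_power A V 0) = rel_unit (op_rel V)"
    and "op_power A V 0 \<subseteq> vecs (both A)"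
proof -
  have I: "id_space A \<subseteq> vecs (both A)" by (auto simp: id_space_def)
  have I': "pair_vec u v \<in> id_space A \<longleftrightarrow> u \<in> vecs A \<and> u = v" for u v :: "'a \<Rightarrow> 'f"
    unfolding id_space_def mem_Collect_eq vecs_simps pair_vec_simps
    by (auto simp: vecs_def fun_eq_iff) metis
  let ?J = "restriction V (Plain ` A) + contraction V (Dot ` A)"
  have J: "f \<in> ?J \<longleftrightarrow> (\<exists>u v. f = pair_vec u v \<and> u \<in> Domain (op_rel V) \<and> (0, v) \<in> op_rel V)" for f
  proof
    assume "f \<in> ?J"
    then obtain u v where "f = pair_vec u 0 + pair_vec 0 v" "u \<in> Domain (op_rel V)" "pair_vec 0 v \<in> V"
      unfolding set_plus_def mem_Collect_eq Bex_def restriction_iff(1)[OF V] contraction_iff by blast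
    then show "\<exists>u v. f = pair_vec u v \<and> u \<in> Domain (op_rel V) \<and> (0, v) \<in> op_rel V"
      by (auto simp: pair_vec_add)
  next
    assume "\<exists>u v. f = pair_vec u v \<and> u \<in> Domain (op_rel V) \<and> (0, v) \<in> op_rel V"
    then obtain u v where *: "f = pair_vec u v" "u \<in> Domain (op_rel V)" "pair_vec 0 v \<in> V"
      by auto
    then have "f = pair_vec u 0 + pair_vec 0 v" by (simp add: pair_vec_add)
    then show "f \<in> ?J"
      unfolding set_plus_def mem_Collect_eq Bex_def restriction_iff(1)[OF V] contraction_iff
      using * op_rel_bounds(2)[OF V *(3)] by blast
  qed
  then have "?J \<subseteq> vecs (both A)"
    using op_rel_bounds[OF V] by (auto simp: vecs_simps)
  note d = op_rel_dot_plus[OF I this]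
  show "op_power A V 0 \<subseteq> vecs (both A)" using d by simp
  have "op_rel (op_power A V 0) = rel_sum (op_rel (id_space A)) (op_rel ?J)"
    using d by simp
  also have "\<dots> = rel_unit (op_rel V)"
    unfolding rel_sum_def rel_unit_def op_rel_iff I' J Domain_iff using op_rel_bounds[OF V] by auto
  finally show "op_rel (op_power A V 0) = rel_unit (op_rel V)" .
qed

text \<open>
  Relabelling turns \<open>(u, m) \<in> op_rel U\<close> and \<open>(m', v) \<in> op_rel V\<close> into vectors with \<open>m\<close> and
  \<open>m'\<close> on the dummy copy; to match them there is to require \<open>m = m'\<close>.
\<close>
lemma op_rel_star:
  fixes U V :: "('a index \<Rightarrow> 'f::field) set"
  assumes U: "U \<subseteq> vecs (both A)" and V: "V \<subseteq> vecs (both A)"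
  shows "op_rel (star A U V) = op_rel U O op_rel V"
    and "star A U V \<subseteq> vecs (both A)"
proof -
  have X: "dot_to_dummy ` both A = Plain ` A \<union> Dummy ` A"
    and Y: "plain_to_dummy ` both A = Dummy ` A \<union> Dot ` A"
    by (auto simp: image_Un image_image)
  let ?X = "Plain ` A \<union> Dummy ` A" and ?Y = "Dummy ` A \<union> Dot ` A"
  let ?U = "relabel dot_to_dummy (both A) U" and ?V = "relabel plain_to_dummy (both A) V"
  define triple where "triple u m v = case_index u v m" for u m v :: "'a \<Rightarrow> 'f"
  have t [simp]: "triple u m v (Plain a) = u a" "triple u m v (Dot a) = v a"
    "triple u m v (Dummy a) = m a" for u m v a
    by (simp_all add: triple_def)
  have U': "g \<in> ?U \<longleftrightarrow> (\<exists>u m. g = triple u m 0 \<and> pair_vec u m \<in> U)" for g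
  proof
    assume "g \<in> ?U"
    then have g: "g \<in> vecs ?X" and "vrestrict (both A) (g \<circ> dot_to_dummy) \<in> U"
      by (auto simp: relabel_def X)
    moreover from g have "vrestrict (both A) (g \<circ> dot_to_dummy) = pair_vec (g \<circ> Plain) (g \<circ> Dummy)"
      and "g = triple (g \<circ> Plain) (g \<circ> Dummy) 0"
      by (auto simp: index_fun_eq_iff vrestrict_def vecs_def image_iff)
    ultimately show "\<exists>u m. g = triple u m 0 \<and> pair_vec u m \<in> U" by auto
  next
    assume "\<exists>u m. g = triple u m 0 \<and> pair_vec u m \<in> U"
    then obtain u m where g: "g = triple u m 0" and um: "pair_vec u m \<in> U" by blast
    note b = op_rel_bounds[OF U um]
    have "g i = 0" if "i \<notin> ?X" for i
      using that b by (cases i) (auto simp: g vecs_def)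
    then have "g \<in> vecs ?X" by (simp add: vecs_def)
    moreover have "vrestrict (both A) (g \<circ> dot_to_dummy) = pair_vec u m"
      using b by (auto simp: g index_fun_eq_iff vrestrict_def vecs_def)
    ultimately show "g \<in> ?U" using um by (simp add: relabel_def X)
  qed
  have V': "h \<in> ?V \<longleftrightarrow> (\<exists>m v. h = triple 0 m v \<and> pair_vec m v \<in> V)" for h
  proof
    assume "h \<in> ?V"
    then have h: "h \<in> vecs ?Y" and "vrestrict (both A) (h \<circ> plain_to_dummy) \<in> V"
      by (auto simp: relabel_def Y)
    moreover from h have "vrestrict (both A) (h \<circ> plain_to_dummy) = pair_vec (h \<circ> Dummy) (h \<circ> Dot)"
      and "h = triple 0 (h \<circ> Dummy) (h \<circ> Dot)"
      by (auto simp: index_fun_eq_iff vrestrict_def vecs_def image_iff)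
    ultimately show "\<exists>m v. h = triple 0 m v \<and> pair_vec m v \<in> V" by auto
  next
    assume "\<exists>m v. h = triple 0 m v \<and> pair_vec m v \<in> V"
    then obtain m v where h: "h = triple 0 m v" and mv: "pair_vec m v \<in> V" by blast
    note b = op_rel_bounds[OF V mv]
    have "h i = 0" if "i \<notin> ?Y" for i
      using that b by (cases i) (auto simp: h vecs_def)
    then have "h \<in> vecs ?Y" by (simp add: vecs_def)
    moreover have "vrestrict (both A) (h \<circ> plain_to_dummy) = pair_vec m v"
      using b by (auto simp: h index_fun_eq_iff vrestrict_def vecs_def)
    ultimately show "h \<in> ?V" using mv by (simp add: relabel_def Y)
  qed
  have XY: "?X - ?Y = Plain ` A" "?Y - ?X = Dot ` A" "?X \<inter> ?Y = Dummy ` A" by auto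
  have eq: "vrestrict (Plain ` A) (triple u m 0) + vrestrict (Dot ` A) (triple 0 m' v) = pair_vec u v"
    if "u \<in> vecs A" "v \<in> vecs A" for u m m' v
    using that by (auto simp: index_fun_eq_iff vrestrict_def vecs_def)
  have agree: "(\<forall>i\<in>Dummy ` A. triple u m 0 i = triple 0 m' v i) \<longleftrightarrow> m = m'"
    if "m \<in> vecs A" "m' \<in> vecs A" for u m m' v
    using that by (auto simp: vecs_def fun_eq_iff)
  have "f \<in> star A U V \<longleftrightarrow> (\<exists>u m v. f = pair_vec u v \<and> pair_vec u m \<in> U \<and> pair_vec m v \<in> V)" for f
  proof
    assume "f \<in> star A U V"
    then obtain u m m' v where *: "pair_vec u m \<in> U" "pair_vec m' v \<in> V"
      and f: "f = vrestrict (Plain ` A) (triple u m 0) + vrestrict (Dot ` A) (triple 0 m' v)"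
      and mm: "\<forall>i\<in>Dummy ` A. triple u m 0 i = triple 0 m' v i"
      unfolding star_def matched_def XY U' V' by blast
    note b = op_rel_bounds[OF U *(1)] op_rel_bounds[OF V *(2)]
    show "\<exists>u m v. f = pair_vec u v \<and> pair_vec u m \<in> U \<and> pair_vec m v \<in> V"
      using * f mm eq[OF b(1,4)] agree[OF b(2,3)] by blast
  next
    assume "\<exists>u m v. f = pair_vec u v \<and> pair_vec u m \<in> U \<and> pair_vec m v \<in> V"
    then obtain u m v where f: "f = pair_vec u v" and *: "pair_vec u m \<in> U" "pair_vec m v \<in> V"
      by blast
    note b = op_rel_bounds[OF U *(1)] op_rel_bounds[OF V *(2)]
    show "f \<in> star A U V"
      unfolding star_def matched_def XY U' V' mem_Collect_eq
      using * f eq[OF b(1,4), of m m] agree[OF b(2,3)] by metis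
  qed
  then show "op_rel (star A U V) = op_rel U O op_rel V" and "star A U V \<subseteq> vecs (both A)"
    using op_rel_bounds[OF U] op_rel_bounds[OF V]
    by (auto simp: op_rel_def relcomp_unfold vecs_simps)
qed

section \<open>Genops and decoupled spaces as relations\<close>

lemma relabel_dot_iff:
  fixes T :: "('a index \<Rightarrow> 'f::field) set"
  shows "f \<in> relabel dot_to_plain (Dot ` A) T \<longleftrightarrow> (\<exists>u\<in>vecs A. f = pair_vec u 0 \<and> pair_vec 0 u \<in> T)"
proof -
  have "vrestrict (Dot ` A) (pair_vec u 0 \<circ> dot_to_plain) = pair_vec 0 u" if "u \<in> vecs A" for u :: "'a \<Rightarrow> 'f"
    using that by (auto simp: index_fun_eq_iff vrestrict_def vecs_def)
  then show ?thesis
    unfolding relabel_def image_image dot_to_plain.simps vecs_iff(2) mem_Collect_eq Bex_def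
    by metis
qed

lemma relabel_restriction_iff:
  assumes "V \<subseteq> vecs (both A)"
  shows "f \<in> relabel dot_to_plain (Dot ` A) (restriction V (Dot ` A)) \<longleftrightarrow>
    (\<exists>u\<in>Range (op_rel V). f = pair_vec u 0)"
  unfolding relabel_dot_iff restriction_iff[OF assms] using op_rel_bounds[OF assms]
  by (simp add: Bex_def Range_iff) metis

lemma relabel_contraction_iff:
  assumes "V \<subseteq> vecs (both A)"
  shows "f \<in> relabel dot_to_plain (Dot ` A) (contraction V (Dot ` A)) \<longleftrightarrow>
    (\<exists>u. (0, u) \<in> op_rel V \<and> f = pair_vec u 0)"
  unfolding relabel_dot_iff contraction_iff using op_rel_bounds[OF assms]
  by (simp add: Bex_def) metis

lemma genop_Range_subset_Domain:
  assumes "genop A V"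
  shows "Range (op_rel V) \<subseteq> Domain (op_rel V)"
proof
  have V: "V \<subseteq> vecs (both A)"
    and sub: "relabel dot_to_plain (Dot ` A) (restriction V (Dot ` A)) \<subseteq> restriction V (Plain ` A)"
    using assms by (auto simp: genop_def space_on_def)
  fix u assume "u \<in> Range (op_rel V)"
  then have "pair_vec u 0 \<in> relabel dot_to_plain (Dot ` A) (restriction V (Dot ` A))"
    unfolding relabel_restriction_iff[OF V] by blast
  then have "pair_vec u 0 \<in> restriction V (Plain ` A)" using sub by blast
  then show "u \<in> Domain (op_rel V)" unfolding restriction_iff[OF V] by simp
qed

lemma Domain_eq_Range:
  assumes V: "V \<subseteq> vecs (both A)"
    and "restriction V (Plain ` A) = relabel dot_to_plain (Dot ` A) (restriction V (Dot ` A))"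
  shows "Domain (op_rel V) = Range (op_rel V)"
proof -
  have "u \<in> Domain (op_rel V) \<longleftrightarrow> u \<in> Range (op_rel V)" for u
    using assms(2)[unfolded set_eq_iff relabel_restriction_iff[OF V] restriction_iff[OF V],
      THEN spec, of "pair_vec u 0"]
    by simp
  then show ?thesis by blast
qed

lemma kernels_eq:
  assumes V: "V \<subseteq> vecs (both A)"
    and "contraction V (Plain ` A) = relabel dot_to_plain (Dot ` A) (contraction V (Dot ` A))"
  shows "(u, 0) \<in> op_rel V \<longleftrightarrow> (0, u) \<in> op_rel V"
  using assms(2)[unfolded set_eq_iff relabel_contraction_iff[OF V] contraction_iff,
      THEN spec, of "pair_vec u 0"] op_rel_bounds(1)[OF V, of u 0]
  by (simp add: Bex_def) blast

text \<open>
  If \<open>op_rel V = X \<times> Y\<close>, then \<open>X\<close> and \<open>Y\<close> contain \<open>0\<close>, so the two contractions of \<open>V\<close> are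
  copies of \<open>X\<close> and \<open>Y\<close> and serve as the direct summands.
\<close>
lemma decoupled_iff_product:
  assumes "space_on (both A) V"
  shows "decoupled A V \<longleftrightarrow> (\<exists>X Y. op_rel V = X \<times> Y)"
proof
  assume "decoupled A V"
  then obtain U1 U2 where U: "U1 \<subseteq> vecs (Plain ` A)" "U2 \<subseteq> vecs (Dot ` A)" and V: "V = U1 + U2"
    unfolding decoupled_def space_on_def by blast
  have "pair_vec u v \<in> V \<longleftrightarrow> pair_vec u 0 \<in> U1 \<and> pair_vec 0 v \<in> U2" for u v
  proof
    assume "pair_vec u v \<in> V"
    then obtain f g where fg: "f \<in> U1" "g \<in> U2" "pair_vec u v = f + g"
      unfolding V set_plus_def by blast
    obtain u' v' where "f = pair_vec u' 0" "g = pair_vec 0 v'"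
      using fg U by (blast dest: vecs_cases(2,3))
    then show "pair_vec u 0 \<in> U1 \<and> pair_vec 0 v \<in> U2" using fg by (simp add: pair_vec_add)
  next
    assume "pair_vec u 0 \<in> U1 \<and> pair_vec 0 v \<in> U2"
    then have "pair_vec u 0 + pair_vec 0 v \<in> V" unfolding V by blast
    then show "pair_vec u v \<in> V" by (simp add: pair_vec_add)
  qed
  then have "op_rel V = {u. pair_vec u 0 \<in> U1} \<times> {v. pair_vec 0 v \<in> U2}" by auto
  then show "\<exists>X Y. op_rel V = X \<times> Y" by blast
next
  assume "\<exists>X Y. op_rel V = X \<times> Y"
  then obtain X Y where XY: "pair_vec u v \<in> V \<longleftrightarrow> u \<in> X \<and> v \<in> Y" for u v
    by (auto simp: set_eq_iff)
  have V: "V \<subseteq> vecs (both A)" and sub: "fun_space.subspace V"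
    using assms by (auto simp: space_on_def)
  have "0 \<in> V" using sub by (rule fun_space.subspace_0)
  then have 0: "0 \<in> X" "0 \<in> Y" using XY[of 0 0] by (auto simp: pair_vec_zero)
  have *: "fun_space.subspace (vecs Z \<inter> V)" for Z
    using sub unfolding fun_space.subspace_def by (auto simp: vecs_def fscale_def)
  have "contraction V Z = vecs Z \<inter> V" for Z by (auto simp: contraction_def)
  then have on: "space_on Z (contraction V Z)" for Z using * by (simp add: space_on_def)
  have "V = contraction V (Plain ` A) + contraction V (Dot ` A)"
  proof
    show "V \<subseteq> contraction V (Plain ` A) + contraction V (Dot ` A)"
    proof
      fix f assume "f \<in> V"
      then obtain u v where f: "f = pair_vec u v" using V vecs_cases(1) by blast
      then have "pair_vec u 0 \<in> contraction V (Plain ` A)" "pair_vec 0 v \<in> contraction V (Dot ` A)"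
        using \<open>f \<in> V\<close> op_rel_bounds[OF V] 0 by (auto simp: contraction_iff XY)
      moreover have "f = pair_vec u 0 + pair_vec 0 v" by (simp add: f pair_vec_add)
      ultimately show "f \<in> contraction V (Plain ` A) + contraction V (Dot ` A)" by blast
    qed
    show "contraction V (Plain ` A) + contraction V (Dot ` A) \<subseteq> V"
      using sub by (auto simp: contraction_def set_plus_def fun_space.subspace_add)
  qed
  then show "decoupled A V" unfolding decoupled_def 
    by (intro exI[of _ "contraction V (Plain ` A)"] exI[of _ "contraction V (Dot ` A)"] conjI on)
qed

section \<open>Linkage of spaces as linkage of relations\<close>

text \<open>
  With \<open>A\<close> and \<open>B\<close> disjoint, a vector on the plain copies of both is \<open>pair_vec (u + v) 0\<close> for
  unique \<open>u \<in> vecs A\<close> and \<open>v \<in> vecs B\<close>, and similarly for the dotted copies. The sets of names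
  are parameters because they decide how the sum is split.
\<close>
definition plain_rel ::
  "'a set \<Rightarrow> 'a set \<Rightarrow> ('a index \<Rightarrow> 'f::field) set \<Rightarrow> (('a \<Rightarrow> 'f) \<times> ('a \<Rightarrow> 'f)) set" where
  "plain_rel A B V = {(u, v). u \<in> vecs A \<and> v \<in> vecs B \<and> pair_vec (u + v) 0 \<in> V}"

definition dot_rel ::
  "'a set \<Rightarrow> 'a set \<Rightarrow> ('a index \<Rightarrow> 'f::field) set \<Rightarrow> (('a \<Rightarrow> 'f) \<times> ('a \<Rightarrow> 'f)) set" where
  "dot_rel A B V = {(u, v). u \<in> vecs A \<and> v \<in> vecs B \<and> pair_vec 0 (u + v) \<in> V}"

lemma converse_plain_rel: "(plain_rel A B V)\<inverse> = plain_rel B A V"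
  by (auto simp: plain_rel_def add.commute)

lemma converse_dot_rel: "(dot_rel A B V)\<inverse> = dot_rel B A V"
  by (auto simp: dot_rel_def add.commute)

lemma linear_relation_plain_rel:
  assumes "fun_space.subspace V"
  shows "linear_relation (plain_rel A B V)"
proof -
  have zero: "pair_vec (0 + 0) 0 \<in> V"
    using fun_space.subspace_0[OF assms] by (simp add: pair_vec_zero)
  have add: "pair_vec (u + u' + (v + v')) 0 \<in> V"
    if "pair_vec (u + v) 0 \<in> V" "pair_vec (u' + v') 0 \<in> V" for u v u' v'
    using fun_space.subspace_add[OF assms that] by (simp add: pair_vec_add algebra_simps)
  have scale: "pair_vec (fscale c u + fscale c v) 0 \<in> V" if "pair_vec (u + v) 0 \<in> V" for c u v
    using fun_space.subspace_scale[OF assms that, of c]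
    by (simp add: pair_vec_scale fun_space.scale_right_distrib)
  show ?thesis
    unfolding linear_relation_def plain_rel_def
    using zero add scale by (auto simp: vecs_zero vecs_add vecs_scale)
qed

lemma linear_relation_dot_rel:
  assumes "fun_space.subspace V"
  shows "linear_relation (dot_rel A B V)"
proof -
  have zero: "pair_vec 0 (0 + 0) \<in> V"
    using fun_space.subspace_0[OF assms] by (simp add: pair_vec_zero)
  have add: "pair_vec 0 (u + u' + (v + v')) \<in> V"
    if "pair_vec 0 (u + v) \<in> V" "pair_vec 0 (u' + v') \<in> V" for u v u' v'
    using fun_space.subspace_add[OF assms that] by (simp add: pair_vec_add algebra_simps)
  have scale: "pair_vec 0 (fscale c u + fscale c v) \<in> V" if "pair_vec 0 (u + v) \<in> V" for c u v
    using fun_space.subspace_scale[OF assms that, of c]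
    by (simp add: pair_vec_scale fun_space.scale_right_distrib)
  show ?thesis
    unfolding linear_relation_def dot_rel_def
    using zero add scale by (auto simp: vecs_zero vecs_add vecs_scale)
qed

lemma dot_rel_subset_plain_rel:
  assumes "relabel dot_to_plain (Dot ` A \<union> Dot ` B) V2 \<subseteq> V1"
  shows "dot_rel A B V2 \<subseteq> plain_rel A B V1"
proof clarify
  fix u v assume uv: "(u, v) \<in> dot_rel A B V2"
  then have "u + v \<in> vecs (A \<union> B)" "pair_vec 0 (u + v) \<in> V2"
    by (auto simp: dot_rel_def vecs_def)
  then have "pair_vec (u + v) 0 \<in> relabel dot_to_plain (Dot ` (A \<union> B)) V2"
    unfolding relabel_dot_iff by blast
  then show "(u, v) \<in> plain_rel A B V1"
    using assms uv by (auto simp: plain_rel_def dot_rel_def image_Un)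
qed

text \<open>
  An element of \<open>V1 + V2\<close> carries two vectors over \<open>A \<union> B\<close>, one on the plain and one
  on the dotted copy. Splitting both along \<open>A\<close> and \<open>B\<close> gives a pair in \<open>K\<close> and a pair in \<open>L\<close>,
  and matching on \<open>both B\<close> says that their \<open>B\<close>-parts form an element of \<open>VP\<close>.
\<close>
lemma op_rel_matched:
  fixes V1 V2 VP :: "('a index \<Rightarrow> 'f::field) set"
  assumes AB: "A \<inter> B = {}" and P: "VP \<subseteq> vecs (both B)"
    and V1: "V1 \<subseteq> vecs (Plain ` A \<union> Plain ` B)" and V2: "V2 \<subseteq> vecs (Dot ` A \<union> Dot ` B)"
  shows "op_rel (matched (both B) (both A \<union> both B) VP (V1 + V2)) =
      plain_rel A B V1 O op_rel VP O (dot_rel A B V2)\<inverse>"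
    and "matched (both B) (both A \<union> both B) VP (V1 + V2) \<subseteq> vecs (both A)"
proof -
  let ?M = "matched (both B) (both A \<union> both B) VP (V1 + V2)"
  have sets: "both B - (both A \<union> both B) = {}" "(both A \<union> both B) - both B = both A"
    "both B \<inter> (both A \<union> both B) = both B"
    using AB by auto
  have empty: "vrestrict {} g = 0" for g :: "'a index \<Rightarrow> 'f"
    by (simp add: vrestrict_def fun_eq_iff)
  have M: "f \<in> ?M \<longleftrightarrow> (\<exists>g h. f = vrestrict (both A) h \<and> g \<in> VP \<and> h \<in> V1 + V2 \<and>
      (\<forall>i\<in>both B. g i = h i))" for f
    unfolding matched_def sets empty by simp
  show "?M \<subseteq> vecs (both A)"
    unfolding subset_iff M by (auto simp: vecs_def vrestrict_def)
  have "(u, u') \<in> op_rel ?M \<longleftrightarrow>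
      (u, u') \<in> plain_rel A B V1 O op_rel VP O (dot_rel A B V2)\<inverse>" for u u'
  proof
    assume "(u, u') \<in> op_rel ?M"
    then obtain g h1 h2 where uu: "pair_vec u u' = vrestrict (both A) (h1 + h2)"
      and g: "g \<in> VP" and h: "h1 \<in> V1" "h2 \<in> V2"
      and agree: "\<forall>i\<in>both B. g i = (h1 + h2) i"
      unfolding op_rel_iff M by (auto elim!: set_plus_elim)
    have "h1 \<in> vecs (Plain ` (A \<union> B))" "h2 \<in> vecs (Dot ` (A \<union> B))"
      using h V1 V2 by (auto simp: image_Un)
    then obtain x y where x: "x \<in> vecs (A \<union> B)" "h1 = pair_vec x 0"
      and y: "y \<in> vecs (A \<union> B)" "h2 = pair_vec 0 y"
      unfolding vecs_iff by blast
    have hxy: "h1 + h2 = pair_vec x y" by (simp add: x y pair_vec_add)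
    let ?p = "vrestrict B x" and ?q = "vrestrict B y"
    have u: "u = vrestrict A x" "u' = vrestrict A y"
      using uu unfolding hxy index_fun_eq_iff by (auto simp: vrestrict_def image_iff fun_eq_iff)
    have bounds: "u \<in> vecs A" "u' \<in> vecs A" "?p \<in> vecs B" "?q \<in> vecs B"
      by (auto simp: u vecs_def vrestrict_def)
    have split: "vrestrict A z + vrestrict B z = z" if "z \<in> vecs (A \<union> B)" for z :: "'a \<Rightarrow> 'f"
      using that AB by (auto simp: vecs_def vrestrict_def fun_eq_iff)
    have "g = pair_vec ?p ?q"
      using g P agree unfolding hxy
      by (auto simp: index_fun_eq_iff vrestrict_def vecs_def image_iff dest!: subsetD)
    then have "(?p, ?q) \<in> op_rel VP" using g by simp
    moreover have "(u, ?p) \<in> plain_rel A B V1" "(u', ?q) \<in> dot_rel A B V2"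
      using h bounds split[OF x(1)] split[OF y(1)] x y by (simp_all add: plain_rel_def dot_rel_def u)
    ultimately show "(u, u') \<in> plain_rel A B V1 O op_rel VP O (dot_rel A B V2)\<inverse>" by blast
  next
    assume "(u, u') \<in> plain_rel A B V1 O op_rel VP O (dot_rel A B V2)\<inverse>"
    then obtain p q where *: "(u, p) \<in> plain_rel A B V1" "(u', q) \<in> dot_rel A B V2"
      and pq: "pair_vec p q \<in> VP"
      by auto
    from * have b: "u \<in> vecs A" "p \<in> vecs B" "u' \<in> vecs A" "q \<in> vecs B"
      and h: "pair_vec (u + p) 0 \<in> V1" "pair_vec 0 (u' + q) \<in> V2"
      by (auto simp: plain_rel_def dot_rel_def)
    have "pair_vec (u + p) 0 + pair_vec 0 (u' + q) \<in> V1 + V2" using h by (rule set_plus_intro)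
    then have hm: "pair_vec (u + p) (u' + q) \<in> V1 + V2" by (simp add: pair_vec_add)
    have "pair_vec u u' = vrestrict (both A) (pair_vec (u + p) (u' + q))"
      using b AB by (auto simp: index_fun_eq_iff vrestrict_def vecs_def image_iff)
    moreover have "\<forall>i\<in>both B. pair_vec p q i = pair_vec (u + p) (u' + q) i"
      using b AB by (auto simp: vecs_def)
    ultimately show "(u, u') \<in> op_rel ?M" unfolding op_rel_iff M using pq hm by blast
  qed
  then show "op_rel ?M = plain_rel A B V1 O op_rel VP O (dot_rel A B V2)\<inverse>"
    unfolding set_eq_iff split_paired_All by blast
qed

lemma E_linked_iff_linked:
  fixes VW VP V1 V2 :: "('a index \<Rightarrow> 'f::field) set"
  assumes AB: "A \<inter> B = {}"
  shows "E_linked A B VW VP V1 V2 \<longleftrightarrow>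
     space_on (both A) VW \<and> space_on (both B) VP \<and>
     space_on (Plain ` A \<union> Plain ` B) V1 \<and> space_on (Dot ` A \<union> Dot ` B) V2 \<and>
     relabel dot_to_plain (Dot ` A \<union> Dot ` B) V2 \<subseteq> V1 \<and>
     linked (plain_rel A B V1) (dot_rel A B V2) (op_rel VW) (op_rel VP)"
proof -
  let ?K = "plain_rel A B V1" and ?L = "dot_rel A B V2"
  let ?MW = "matched (both B) (both A \<union> both B) VP (V1 + V2)"
  let ?MP = "matched (both A) (both A \<union> both B) VW (V1 + V2)"
  have "VW = ?MW \<and> VP = ?MP \<longleftrightarrow> linked ?K ?L (op_rel VW) (op_rel VP)"
    if W: "space_on (both A) VW" and P: "space_on (both B) VP"
      and V1: "space_on (Plain ` A \<union> Plain ` B) V1" and V2: "space_on (Dot ` A \<union> Dot ` B) V2"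
      and sub: "relabel dot_to_plain (Dot ` A \<union> Dot ` B) V2 \<subseteq> V1"
  proof -
    have bounds: "VW \<subseteq> vecs (both A)" "VP \<subseteq> vecs (both B)"
      "V1 \<subseteq> vecs (Plain ` A \<union> Plain ` B)" "V2 \<subseteq> vecs (Dot ` A \<union> Dot ` B)"
      and subspaces: "fun_space.subspace V1" "fun_space.subspace V2"
      using W P V1 V2 by (auto simp: space_on_def)
    have BA: "B \<inter> A = {}" using AB by blast
    have eqW: "op_rel ?MW = ?K O op_rel VP O ?L\<inverse>" and MW: "?MW \<subseteq> vecs (both A)"
      using op_rel_matched[OF AB bounds(2-4)] .
    have "op_rel ?MP = plain_rel B A V1 O op_rel VW O (dot_rel B A V2)\<inverse>" and MP: "?MP \<subseteq> vecs (both B)"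
      using op_rel_matched[OF BA bounds(1), of V1 V2] bounds(3,4) by (simp_all add: Un_commute)
    then have eqP: "op_rel ?MP = ?K\<inverse> O op_rel VW O ?L"
      unfolding converse_plain_rel converse_dot_rel by simp
    have "linear_relation (op_rel VW)" "linear_relation (op_rel VP)"
      using W P by (auto simp: space_on_iff_linear_relation)
    then have "linked ?K ?L (op_rel VW) (op_rel VP) \<longleftrightarrow>
        op_rel VW = op_rel ?MW \<and> op_rel VP = op_rel ?MP"
      unfolding linked_def eqW eqP
      using linear_relation_plain_rel[OF subspaces(1)] linear_relation_dot_rel[OF subspaces(2)]
        dot_rel_subset_plain_rel[OF sub] by metis
    then show ?thesis
      using op_rel_inject[OF bounds(1) MW] op_rel_inject[OF bounds(2) MP] by metis
  qed
  then show ?thesis unfolding E_linked_def by blast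
qed

lemma E_linked_dest:
  assumes "A \<inter> B = {}" and "E_linked A B U V V1 V2"
  shows "space_on (both A) U" and "space_on (both B) V"
    and "linked (plain_rel A B V1) (dot_rel A B V2) (op_rel U) (op_rel V)"
  using assms(2) unfolding E_linked_iff_linked[OF assms(1)] by blast+

text \<open>
  The conditions on \<open>V1\<close> and \<open>V2\<close> alone are inherited from any pair already linked through them.
\<close>
lemma E_linked_transfer:
  assumes "A \<inter> B = {}" and "E_linked A B U V V1 V2"
    and "space_on (both A) U'" and "space_on (both B) V'"
    and "linked (plain_rel A B V1) (dot_rel A B V2) (op_rel U') (op_rel V')"
  shows "E_linked A B U' V' V1 V2"
  using assms(2-) unfolding E_linked_iff_linked[OF assms(1)] by blast

lemma space_onI:
  "V \<subseteq> vecs (both A) \<Longrightarrow> linear_relation (op_rel V) \<Longrightarrow> space_on (both A) V"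
  by (simp add: space_on_iff_linear_relation)

lemma space_on_dest:
  "space_on (both A) V \<Longrightarrow> V \<subseteq> vecs (both A)"
  "space_on (both A) V \<Longrightarrow> linear_relation (op_rel V)"
  by (simp_all add: space_on_iff_linear_relation)

lemma op_rel_operations:
  assumes U: "space_on (both A) U" and V: "space_on (both A) V"
  shows "op_rel (dot_plus A U V) = rel_sum (op_rel U) (op_rel V)"
    and "op_rel (dot_scale A c V) = rel_scale c (op_rel V)"
    and "op_rel (star A U V) = op_rel U O op_rel V"
    and "op_rel (op_power A V 0) = rel_unit (op_rel V)"
  using space_on_dest[OF U] space_on_dest[OF V]
  by (simp_all only: op_rel_dot_plus op_rel_dot_scale op_rel_star op_rel_power_0)

lemma space_on_operations:
  assumes U: "space_on (both A) U" and V: "space_on (both A) V"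
  shows "space_on (both A) (dot_plus A U V)"
    and "space_on (both A) (dot_scale A c V)"
    and "space_on (both A) (star A U V)"
    and "space_on (both A) (op_power A V 0)"
proof -
  note u = space_on_dest[OF U] and v = space_on_dest[OF V]
  show "space_on (both A) (dot_plus A U V)"
    by (rule space_onI[OF op_rel_dot_plus(2)[OF u(1) v(1)]])
      (simp only: op_rel_operations[OF U V] linear_relation_rel_sum u v)
  show "space_on (both A) (dot_scale A c V)"
    by (rule space_onI[OF op_rel_dot_scale(2)[OF v(1)]])
      (simp only: op_rel_operations[OF U V] linear_relation_rel_scale v)
  show "space_on (both A) (star A U V)"
    by (rule space_onI[OF op_rel_star(2)[OF u(1) v(1)]])
      (simp only: op_rel_operations[OF U V] linear_relation_relcomp u v)
  show "space_on (both A) (op_power A V 0)"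
    by (rule space_onI[OF op_rel_power_0(2)[OF v(1)]])
      (simp only: op_rel_operations[OF U V] linear_relation_rel_unit v)
qed

lemma E_linked_dot_plus:
  assumes AB: "A \<inter> B = {}" and l: "E_linked A B U V V1 V2" "E_linked A B U' V' V1 V2"
    and dom: "Domain (op_rel U') \<subseteq> Domain (op_rel U)" "Domain (op_rel V') \<subseteq> Domain (op_rel V)"
  shows "E_linked A B (dot_plus A U U') (dot_plus B V V') V1 V2"
proof -
  note d = E_linked_dest[OF AB l(1)] and d' = E_linked_dest[OF AB l(2)]
  show ?thesis
    using linked_rel_sum[OF d(3) d'(3) dom(2,1)]
    by (intro E_linked_transfer[OF AB l(1)] space_on_operations d d')
      (simp only: op_rel_operations[OF d(1) d'(1)] op_rel_operations[OF d(2) d'(2)])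
qed

lemma E_linked_dot_scale:
  assumes AB: "A \<inter> B = {}" and l: "E_linked A B U V V1 V2"
  shows "E_linked A B (dot_scale A c U) (dot_scale B c V) V1 V2"
proof -
  note d = E_linked_dest[OF AB l]
  show ?thesis
    using linked_rel_scale[OF d(3), of c]
    by (intro E_linked_transfer[OF AB l] space_on_operations(2)[OF d(1) d(1)]
        space_on_operations(2)[OF d(2) d(2)])
      (simp only: op_rel_operations[OF d(1) d(1)] op_rel_operations[OF d(2) d(2)])
qed

lemma E_linked_star:
  assumes AB: "A \<inter> B = {}" and l: "E_linked A B U' V' V1 V2" "E_linked A B U V V1 V2"
    and ran: "Range (op_rel U') \<subseteq> Domain (op_rel U)" "Range (op_rel V') \<subseteq> Domain (op_rel V)"
  shows "E_linked A B (star A U' U) (star B V' V) V1 V2"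
proof -
  note d = E_linked_dest[OF AB l(2)] and d' = E_linked_dest[OF AB l(1)]
  show ?thesis
    using linked_relcomp[OF d(3) d'(3) ran(2,1)]
    by (intro E_linked_transfer[OF AB l(1)] space_on_operations d d')
      (simp only: op_rel_operations[OF d'(1) d(1)] op_rel_operations[OF d'(2) d(2)])
qed

lemma E_linked_power_0:
  assumes AB: "A \<inter> B = {}" and l: "E_linked A B U V V1 V2"
    and "restriction U (Plain ` A) = relabel dot_to_plain (Dot ` A) (restriction U (Dot ` A))"
    and "contraction U (Plain ` A) = relabel dot_to_plain (Dot ` A) (contraction U (Dot ` A))"
    and "restriction V (Plain ` B) = relabel dot_to_plain (Dot ` B) (restriction V (Dot ` B))"
    and "contraction V (Plain ` B) = relabel dot_to_plain (Dot ` B) (contraction V (Dot ` B))"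
  shows "E_linked A B (op_power A U 0) (op_power B V 0) V1 V2"
proof -
  note d = E_linked_dest[OF AB l]
  note U = space_on_dest(1)[OF d(1)] and V = space_on_dest(1)[OF d(2)]
  have "linked (plain_rel A B V1) (dot_rel A B V2) (rel_unit (op_rel U)) (rel_unit (op_rel V))"
    by (intro linked_rel_unit d Domain_eq_Range[OF U assms(3)] Domain_eq_Range[OF V assms(5)]
        kernels_eq[OF U assms(4)] kernels_eq[OF V assms(6)])
  then show ?thesis
    by (intro E_linked_transfer[OF AB l] space_on_operations(4)[OF d(1) d(1)]
        space_on_operations(4)[OF d(2) d(2)])
      (simp only: op_rel_operations[OF d(1) d(1)] op_rel_operations[OF d(2) d(2)])
qed

lemma E_linked_decoupled_iff:
  assumes AB: "A \<inter> B = {}" and l: "E_linked A B U V V1 V2"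
  shows "decoupled A U \<longleftrightarrow> decoupled B V"
proof -
  note d = E_linked_dest[OF AB l]
  show ?thesis
    unfolding decoupled_iff_product[OF d(1)] decoupled_iff_product[OF d(2)]
    using linked_product[OF d(3)] linked_product[OF linked_sym[OF d(3)]] by metis
qed

section \<open>Powers and polynomials\<close>

lemma genop_space_on: "genop A V \<Longrightarrow> space_on (both A) V"
  by (simp add: genop_def)

text \<open>
  For a genop every step of a path of relations can be continued, so composition does not shrink
  the domain; the last step of the path bounds the range. Both facts are the side conditions of
  the linkage of products and sums.
\<close>
lemma op_power_Suc_bounds:
  assumes V: "genop A V"
  shows "space_on (both A) (op_power A V (Suc k)) \<and>
    Range (op_rel (op_power A V (Suc k))) \<subseteq> Range (op_rel V) \<and>
    Domain (op_rel (op_power A V (Suc k))) = Domain (op_rel V)"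
proof (induction k)
  case 0
  show ?case using genop_space_on[OF V] by simp
next
  case (Suc k)
  let ?U = "op_power A V (Suc k)"
  have "op_rel (star A ?U V) = op_rel ?U O op_rel V"
    using Suc genop_space_on[OF V] by (intro op_rel_operations(3)) simp_all
  moreover have "Range (op_rel ?U O op_rel V) \<subseteq> Range (op_rel V)" by blast
  moreover have "Domain (op_rel ?U O op_rel V) = Domain (op_rel ?U)"
  proof -
    have "Range (op_rel ?U) \<subseteq> Domain (op_rel V)"
      using Suc genop_Range_subset_Domain[OF V] by (blast del: subsetI intro: subset_trans)
    then show ?thesis by blast
  qed
  ultimately show ?case using Suc space_on_operations(3)[OF _ genop_space_on[OF V], of ?U] by simp
qed

lemma op_power_bounds:
  assumes V: "genop A V"
  shows "space_on (both A) (op_power A V k)"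
    and "Domain (op_rel (op_power A V k)) = Domain (op_rel V)"
proof -
  note s = genop_space_on[OF V]
  have "space_on (both A) (op_power A V k) \<and> Domain (op_rel (op_power A V k)) = Domain (op_rel V)"
  proof (cases k)
    case 0
    have "Domain (op_rel (op_power A V 0)) = Domain (op_rel V)"
      unfolding op_rel_operations(4)[OF s s] by (rule Domain_rel_unit[OF space_on_dest(2)[OF s]])
    then show ?thesis using 0 space_on_operations(4)[OF s s] by blast
  next
    case (Suc j)
    then show ?thesis using op_power_Suc_bounds[OF V] by blast
  qed
  then show "space_on (both A) (op_power A V k)"
    and "Domain (op_rel (op_power A V k)) = Domain (op_rel V)" by blast+
qed

lemma Domain_dot_scale:
  assumes "space_on (both A) V"
  shows "Domain (op_rel (dot_scale A c V)) = Domain (op_rel V)"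
  unfolding op_rel_operations(2)[OF assms assms] by (rule Domain_rel_scale[OF space_on_dest(2)[OF assms]])

lemma monomial_bounds:
  assumes V: "genop A V"
  shows "space_on (both A) (dot_scale A c (op_power A V k))"
    and "Domain (op_rel (dot_scale A c (op_power A V k))) = Domain (op_rel V)"
proof -
  note P = op_power_bounds[OF V, of k]
  show "space_on (both A) (dot_scale A c (op_power A V k))"
    by (rule space_on_operations(2)[OF P(1) P(1)])
  show "Domain (op_rel (dot_scale A c (op_power A V k))) = Domain (op_rel V)"
    by (simp only: Domain_dot_scale[OF P(1)] P(2))
qed

lemma op_sum_bounds:
  assumes V: "genop A V"
  shows "space_on (both A) (op_sum A \<alpha> V n)"
    and "Domain (op_rel (op_sum A \<alpha> V n)) = Domain (op_rel V)"
proof (induction n)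
  case 0
  {
    case 1
    show ?case unfolding op_sum.simps(1) by (rule monomial_bounds[OF V])
  next
    case 2
    show ?case unfolding op_sum.simps(1) by (rule monomial_bounds[OF V])
  }
next
  case (Suc n)
  note T = monomial_bounds[OF V, of "\<alpha> (Suc n)" "Suc n"]
  {
    case 1
    show ?case unfolding op_sum.simps(2) by (rule space_on_operations(1)[OF Suc(1) T(1)])
  next
    case 2
    show ?case
      unfolding op_sum.simps(2) op_rel_operations(1)[OF Suc(1) T(1)] Domain_rel_sum T(2) Suc(2)
      by (rule Int_absorb)
  }
qed

lemma E_linked_power_Suc:
  assumes AB: "A \<inter> B = {}" and g: "genop A VW" "genop B VP"
    and l: "E_linked A B VW VP V1 V2"
  shows "E_linked A B (op_power A VW (Suc k)) (op_power B VP (Suc k)) V1 V2"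
proof (induction k)
  case 0
  show ?case using l by simp
next
  case (Suc k)
  show ?case
    unfolding op_power.simps
    using op_power_Suc_bounds[OF g(1), of k] op_power_Suc_bounds[OF g(2), of k]
      genop_Range_subset_Domain[OF g(1)] genop_Range_subset_Domain[OF g(2)]
    by (intro E_linked_star[OF AB Suc l]) blast+
qed

text \<open>
  Only the summand of exponent \<open>0\<close> can fail to be linked, so its linkage is a hypothesis.
\<close>
lemma E_linked_op_sum:
  assumes AB: "A \<inter> B = {}" and g: "genop A VW" "genop B VP"
    and l: "E_linked A B VW VP V1 V2"
    and l0: "E_linked A B (op_sum A \<alpha> VW 0) (op_sum B \<alpha> VP 0) V1 V2"
  shows "E_linked A B (op_sum A \<alpha> VW n) (op_sum B \<alpha> VP n) V1 V2"
proof (induction n)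
  case 0
  show ?case by (rule l0)
next
  case (Suc n)
  show ?case
    unfolding op_sum.simps(2)
    by (intro E_linked_dot_plus[OF AB Suc] E_linked_dot_scale[OF AB] E_linked_power_Suc[OF AB g l])
      (simp_all only: op_sum_bounds[OF g(1)] op_sum_bounds[OF g(2)]
        monomial_bounds[OF g(1)] monomial_bounds[OF g(2)] subset_refl)
qed

lemma dot_scale_0_power_0:
  assumes V: "space_on (both A) V"
  shows "dot_scale A 0 (op_power A V 0) = dot_scale A 0 V"
proof (rule op_rel_inject)
  note P = space_on_operations(4)[OF V V]
  show "op_rel (dot_scale A 0 (op_power A V 0)) = op_rel (dot_scale A 0 V)"
    unfolding op_rel_operations(2)[OF P P] op_rel_operations(2)[OF V V] op_rel_operations(4)[OF V V]
    using V by (intro rel_scale_0_rel_unit) (simp add: space_on_iff_linear_relation)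
  show "dot_scale A 0 (op_power A V 0) \<subseteq> vecs (both A)" "dot_scale A 0 V \<subseteq> vecs (both A)"
    using space_on_operations(2)[OF P P] space_on_operations(2)[OF V V] by (auto simp: space_on_def)
qed

theorem theorem74:
  fixes A B :: "'a set"
    and VW VP V1 V2 :: "('a index \<Rightarrow> 'f::field) set"
  assumes "finite A" and "finite B" and "A \<inter> B = {}"
    and "genop A VW" and "genop B VP"
    and "E_linked A B VW VP V1 V2"
  shows
    "(\<forall>p :: 'f poly. coeff p 0 = 0 \<longrightarrow>
        E_linked A B (op_poly A p VW) (op_poly B p VP) V1 V2 \<and>
        (decoupled A (op_poly A p VW) \<longleftrightarrow> decoupled B (op_poly B p VP)))
     \<and>
     (restriction VW (Plain ` A) = relabel dot_to_plain (Dot ` A) (restriction VW (Dot ` A)) \<and>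
      contraction VW (Plain ` A) = relabel dot_to_plain (Dot ` A) (contraction VW (Dot ` A)) \<and>
      restriction VP (Plain ` B) = relabel dot_to_plain (Dot ` B) (restriction VP (Dot ` B)) \<and>
      contraction VP (Plain ` B) = relabel dot_to_plain (Dot ` B) (contraction VP (Dot ` B))
      \<longrightarrow>
        E_linked A B (op_power A VW 0) (op_power B VP 0) V1 V2 \<and>
        (\<forall>p :: 'f poly.
           E_linked A B (op_poly A p VW) (op_poly B p VP) V1 V2 \<and>
           (decoupled A (op_poly A p VW) \<longleftrightarrow> decoupled B (op_poly B p VP))))"
proof -
  note AB = assms(3) and g = assms(4,5) and l = assms(6)
  have poly: "E_linked A B (op_poly A p VW) (op_poly B p VP) V1 V2 \<and>
      (decoupled A (op_poly A p VW) \<longleftrightarrow> decoupled B (op_poly B p VP))"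
    if "E_linked A B (op_sum A (coeff p) VW 0) (op_sum B (coeff p) VP 0) V1 V2" for p
    using E_linked_op_sum[OF AB g l that, of "degree p"] E_linked_decoupled_iff[OF AB]
    unfolding op_poly_def by blast
  have no_constant_term: "E_linked A B (op_poly A p VW) (op_poly B p VP) V1 V2 \<and>
      (decoupled A (op_poly A p VW) \<longleftrightarrow> decoupled B (op_poly B p VP))"
    if p: "coeff p 0 = 0" for p
  proof (rule poly)
    show "E_linked A B (op_sum A (coeff p) VW 0) (op_sum B (coeff p) VP 0) V1 V2"
      unfolding op_sum.simps(1) p dot_scale_0_power_0[OF genop_space_on[OF g(1)]]
        dot_scale_0_power_0[OF genop_space_on[OF g(2)]]
      by (rule E_linked_dot_scale[OF AB l])
  qed
  have with_constant_term: "E_linked A B (op_poly A p VW) (op_poly B p VP) V1 V2 \<and>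
      (decoupled A (op_poly A p VW) \<longleftrightarrow> decoupled B (op_poly B p VP))"
    if zero: "E_linked A B (op_power A VW 0) (op_power B VP 0) V1 V2" for p
    using poly[of p] E_linked_dot_scale[OF AB zero] unfolding op_sum.simps(1) by blast
  show ?thesis
    using no_constant_term with_constant_term E_linked_power_0[OF AB l] by blast
qed

end
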